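(* (Weak Maximum Principle.) Let $N\ge2$, $0<s<1$, $\lambda<\frac{(N-1)^2}{4}$, and let $$Lu:=-\Delta_{\mathbb{B}^N}u+(-\Delta_{\mathbb{B}^N})^su-\lambda u.$$ Let $u\in H^1(\mathbb{B}^N)$ satisfy $Lu\ge0$ in $\mathbb{B}^N$ in the weak sense. Then $u\ge0$ (almost everywhere) in $\mathbb{B}^N$.
   Context: $\mathbb{B}^N$ is the ball model of hyperbolic space: the Euclidean unit ball $\{x\in\mathbb{R}^N:|x|<1\}$ with Riemannian metric $\left(\frac{2}{1-|x|^2}\right)^2dx^2$ and volume element $dV_{\mathbb{B}^N}=\left(\frac{2}{1-|x|^2}\right)^N dx$. $\nabla_{\mathbb{B}^N}$ and $\Delta_{\mathbb{B}^N}$ are the Riemannian gradient and the Laplace–Beltrami operator; products of gradients are taken in the hyperbolic metric. The hyperbolic distance is $d(x,y)=\log\frac{1+|T_x(y)|}{1-|T_x(y)|}$, where $T_a(x)=\frac{|x-a|^2a-(1-|a|^2)(x-a)}{1-2x\cdot a+|x|^2|a|^2}$. $H^1(\mathbb{B}^N)$ is the (real) Sobolev space on $\mathbb{B}^N$ with norm $\|u\|=\left(\int_{\mathbb{B}^N}|\nabla_{\mathbb{B}^N}u|^2dV_{\mathbb{B}^N}\right)^{1/2}$ (completion of $C_0^\infty(\mathbb{B}^N)$; it embeds in $L^2$ because the bottom of the $L^2$-spectrum of $-\Delta_{\mathbb{B}^N}$ is $\frac{(N-1)^2}{4}$). Kernel: for $0<s<1$, $\mathcal{K}_s(\rho)$,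 $\rho>0$, is given, with $K_\nu$ the modified Bessel function of the second kind, by $$\mathcal{K}_s(\rho)=C(N,s)\left(\frac{-\partial_\rho}{\sinh\rho}\right)^{\frac{N-1}{2}}\left(\rho^{-\frac{1+2s}{2}}K_{\frac{1+2s}{2}}\left(\tfrac{N-1}{2}\rho\right)\right)$$ if $N\ge3$ is odd, and $$\mathcal{K}_s(\rho)=C(N,s)\int_\rho^\infty\frac{\sinh r}{\sqrt{\pi}\sqrt{\cosh r-\cosh\rho}}\left(\frac{-\partial_r}{\sinh r}\right)^{\frac N2}\left(r^{-\frac{1+2s}{2}}K_{\frac{1+2s}{2}}\left(\tfrac{N-1}{2}r\right)\right)dr$$ if $N\ge2$ is even, where $$C(N,s)=\frac{\sqrt{\pi}\,2^{2s}\,\Gamma\left(\frac{N+2s}{2}\right)}{2\Gamma(\frac32)\pi^{N/2}|\Gamma(-s)|}\cdot\frac{1}{2^{\frac{N-2+2s}{2}}\Gamma\left(\frac{N+2s}{2}\right)}\left(\frac{N-1}{2}\right)^{\frac{1+2s}{2}}>0.$$ The fractional Laplacian is $(-\Delta_{\mathbb{B}^N})^su(x)=\mathrm{P.V.}\int_{\mathbb{B}^N}(u(x)-u(\xi))\mathcal{K}_s(d(x,\xi))\,dV_{\mathbb{B}^N}(\xi)$. $Lu\ge0$ in the weak sense means: for every $\varphi\in H^1(\mathbb{B}^N)$ with $\varphi\ge0$ a.e., $$\int_{\mathbb{B}^N}\nabla_{\mathbb{B}^N}u\cdot\nabla_{\mathbb{B}^N}\varphi\,dV_{\mathbb{B}^N}+\int_{\mathbb{B}^N}\int_{\mathbb{B}^N}(u(x)-u(y))(\varphi(x)-\varphi(y))\mathcal{K}_s(d(x,y))\,dV_{\mathbb{B}^N}(x)dV_{\mathbb{B}^N}(y)-\lambda\int_{\mathbb{B}^N}u\varphi\,dV_{\mathbb{B}^N}\ge0.$$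 *)

theory Defs
  imports "HOL-Analysis.Analysis"
begin

text \<open>
  The ball model of hyperbolic \<open>N\<close>-space is carried by the open unit ball of a Euclidean space
  \<open>'a\<close> with \<open>DIM('a) = N\<close>. Functions and vector fields on it are total functions on \<open>'a\<close> whose
  values outside the ball are irrelevant. Tangent vectors are elements of \<open>'a\<close>.
\<close>

definition conf_factor :: "'a::euclidean_space \<Rightarrow> real" where
  "conf_factor x = 2 / (1 - (norm x)\<^sup>2)"

definition hyp_inner :: "'a::euclidean_space \<Rightarrow> 'a \<Rightarrow> 'a \<Rightarrow> real" where
  "hyp_inner x v w = (conf_factor x)\<^sup>2 * (v \<bullet> w)"

definition hyp_vol :: "'a::euclidean_space measure" where
  "hyp_vol = density (lebesgue_on (ball 0 1)) (\<lambda>x. ennreal (conf_factor x ^ DIM('a)))"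

definition mobius_T :: "'a::euclidean_space \<Rightarrow> 'a \<Rightarrow> 'a" where
  "mobius_T a x =
     ((norm (x - a))\<^sup>2 *\<^sub>R a - (1 - (norm a)\<^sup>2) *\<^sub>R (x - a)) /\<^sub>R
     (1 - 2 * (x \<bullet> a) + (norm x)\<^sup>2 * (norm a)\<^sup>2)"

definition hyp_dist :: "'a::euclidean_space \<Rightarrow> 'a \<Rightarrow> real" where
  "hyp_dist x y = ln ((1 + norm (mobius_T x y)) / (1 - norm (mobius_T x y)))"


text \<open>\<open>C\<^sup>k\<close> and smooth real functions on the whole space, via iterated partial derivatives.\<close>

primrec C_k :: "nat \<Rightarrow> ('a::euclidean_space \<Rightarrow> real) \<Rightarrow> bool" where
  "C_k 0 f \<longleftrightarrow> continuous_on UNIV f"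
| "C_k (Suc k) f \<longleftrightarrow>
     (\<forall>x. f differentiable (at x)) \<and>
     (\<forall>b\<in>Basis. C_k k (\<lambda>x. frechet_derivative f (at x) b))"

text \<open>\<open>C\<^sub>0\<^sup>\<infinity>\<close> of the ball, each function being identified with its extension by zero.\<close>

definition test_functions :: "('a::euclidean_space \<Rightarrow> real) set" where
  "test_functions =
     {f. (\<forall>k. C_k k f) \<and> compact (closure {x. f x \<noteq> 0}) \<and> closure {x. f x \<noteq> 0} \<subseteq> ball 0 1}"

text \<open>
  Riemannian gradient of a differentiable function: the Euclidean gradient rescaled, so that
  \<open>hyp_inner x (hyp_grad_classical f x) v = frechet_derivative f (at x) v\<close>.
\<close>

definition hyp_grad_classical :: "('a::euclidean_space \<Rightarrow> real) \<Rightarrow> 'a \<Rightarrow> 'a" where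
  "hyp_grad_classical f x =
     (\<Sum>b\<in>Basis. frechet_derivative f (at x) b *\<^sub>R b) /\<^sub>R (conf_factor x)\<^sup>2"

text \<open>
  \<open>H\<^sup>1\<close> is the completion of the test functions for the norm of the gradient in \<open>L\<^sup>2\<close>. By the
  spectral gap a sequence that is Cauchy in this norm is also Cauchy in \<open>L\<^sup>2\<close>, so the completion is
  realised inside \<open>L\<^sup>2\<close>, and the gradient extends to it by continuity: \<open>G\<close> below is the
  \<open>L\<^sup>2\<close>-limit of the gradients of test functions tending to \<open>u\<close>. The limit in \<open>L\<^sup>2\<close> of the functions
  themselves has to be recorded, since the gradient alone does not see additive constants.
\<close>

definition has_hyp_grad :: "('a::euclidean_space \<Rightarrow> real) \<Rightarrow> ('a \<Rightarrow> 'a) \<Rightarrow> bool" where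
  "has_hyp_grad u G \<longleftrightarrow>
     u \<in> borel_measurable hyp_vol \<and> G \<in> borel_measurable hyp_vol \<and>
     (\<exists>f. (\<forall>n::nat. f n \<in> test_functions) \<and>
        (\<lambda>n. \<integral>\<^sup>+x. ennreal ((f n x - u x)\<^sup>2) \<partial>hyp_vol) \<longlonglongrightarrow> 0 \<and>
        (\<lambda>n. \<integral>\<^sup>+x. ennreal (hyp_inner x (hyp_grad_classical (f n) x - G x)
                                     (hyp_grad_classical (f n) x - G x)) \<partial>hyp_vol) \<longlonglongrightarrow> 0)"

definition hyp_H1 :: "('a::euclidean_space \<Rightarrow> real) set" where
  "hyp_H1 = {u. \<exists>G. has_hyp_grad u G}"

text \<open>The gradient of an \<open>H\<^sup>1\<close> function is determined up to a null set; a representative is chosen.\<close>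

definition hyp_grad :: "('a::euclidean_space \<Rightarrow> real) \<Rightarrow> 'a \<Rightarrow> 'a" where
  "hyp_grad u = (SOME G. has_hyp_grad u G)"


text \<open>
  Modified Bessel function of the second kind for \<open>x > 0\<close>, by its standard integral formula, which
  is valid for every real order (the order \<open>1\<close> occurs below, for \<open>s = 1/2\<close>).
\<close>

definition bessel_K :: "real \<Rightarrow> real \<Rightarrow> real" where
  "bessel_K \<nu> x = (LINT t:{0<..}|lborel. exp (- x * cosh t) * cosh (\<nu> * t))"

definition kernel_const :: "nat \<Rightarrow> real \<Rightarrow> real" where
  "kernel_const N s =
     (sqrt pi * 2 powr (2 * s) * Gamma ((real N + 2 * s) / 2)) /
     (2 * Gamma (3 / 2) * pi powr (real N / 2) * \<bar>Gamma (- s)\<bar>) *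
     (1 / (2 powr ((real N - 2 + 2 * s) / 2) * Gamma ((real N + 2 * s) / 2))) *
     ((real N - 1) / 2) powr ((1 + 2 * s) / 2)"

definition radial_op :: "(real \<Rightarrow> real) \<Rightarrow> real \<Rightarrow> real" where
  "radial_op f r = - deriv f r / sinh r"

definition bessel_profile :: "nat \<Rightarrow> real \<Rightarrow> real \<Rightarrow> real" where
  "bessel_profile N s r =
     r powr (- ((1 + 2 * s) / 2)) * bessel_K ((1 + 2 * s) / 2) ((real N - 1) / 2 * r)"

definition frac_kernel :: "nat \<Rightarrow> real \<Rightarrow> real \<Rightarrow> real" where
  "frac_kernel N s \<rho> =
     (if odd N
      then kernel_const N s * (radial_op ^^ ((N - 1) div 2)) (bessel_profile N s) \<rho>
      else kernel_const N s *
        (LINT r:{\<rho><..}|lborel.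
           sinh r / (sqrt pi * sqrt (cosh r - cosh \<rho>)) *
           (radial_op ^^ (N div 2)) (bessel_profile N s) r))"


text \<open>
  The weak form of \<open>-\<Delta> u + (-\<Delta>)\<^sup>s u - \<lambda> u\<close> tested against \<open>\<phi>\<close>. For \<open>u\<close> and \<open>\<phi>\<close> in \<open>H\<^sup>1\<close> and
  \<open>0 < s < 1\<close> all integrals converge absolutely.
\<close>

definition L_form ::
  "real \<Rightarrow> real \<Rightarrow> ('a::euclidean_space \<Rightarrow> real) \<Rightarrow> ('a \<Rightarrow> real) \<Rightarrow> real" where
  "L_form s lam u \<phi> =
     (LINT x|hyp_vol. hyp_inner x (hyp_grad u x) (hyp_grad \<phi> x)) +
     (LINT y|hyp_vol. LINT x|hyp_vol.
        (u x - u y) * (\<phi> x - \<phi> y) * frac_kernel DIM('a) s (hyp_dist x y)) -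
     lam * (LINT x|hyp_vol. u x * \<phi> x)"

definition weak_L_nonneg :: "real \<Rightarrow> real \<Rightarrow> ('a::euclidean_space \<Rightarrow> real) \<Rightarrow> bool" where
  "weak_L_nonneg s lam u \<longleftrightarrow>
     (\<forall>\<phi>\<in>hyp_H1. (AE x in hyp_vol. \<phi> x \<ge> 0) \<longrightarrow> L_form s lam u \<phi> \<ge> 0)"

end

theory Submission
  imports Defs
begin

text \<open>
  Testing the inequality with the negative part \<open>\<phi> = max (- u) 0\<close> makes the gradient term at most
  \<open>- \<integral> \<bar>\<nabla>\<phi>\<bar>\<^sup>2\<close>, the nonlocal term nonpositive and the zeroth-order term equal to \<open>lam \<integral> \<phi>\<^sup>2\<close>, so the
  sharp inequality \<open>(N - 1)\<^sup>2 / 4 \<integral> \<phi>\<^sup>2 \<le> \<integral> \<bar>\<nabla>\<phi>\<bar>\<^sup>2\<close> forces \<open>\<phi> = 0\<close>. The nonlocal term needs only that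
  the kernel is nonnegative: the operator \<open>- (sinh r)\<^sup>-\<^sup>1 d/dr\<close> maps \<open>r\<^sup>-\<^sup>\<nu> K\<^sub>\<nu> (a r)\<close> to
  \<open>a (r / sinh r) r\<^sup>-\<^sup>\<nu> K\<^bsub>\<nu>+1\<^esub> (a r)\<close>, and its iterates keep \<open>r / sinh r\<close> positive.
\<close>

section \<open>Positivity of the kernel\<close>

text \<open>\<open>hyp_H1\<close> is given only through \<open>L\<^sup>2\<close> limits of test
  functions, and \<open>hyp_grad\<close> is a choice among the possible limits of gradients.
  Inserting the negative part therefore requires two facts: limit gradients agree almost everywhere,
  and the negative part of \<open>u\<close> has as gradient a bounded multiple of the gradient of
  \<open>u\<close>. The first is closability of the gradient, obtained by moving the derivative onto
  a test function, where it becomes the Laplace-Beltrami operator. For the second, the negative part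
  is not smooth, so it is approached by smooth functions of \<open>u\<close> that vanish where
  \<open>u\<close> does and hence preserve compact support. For the kernel no closed formula for the
  iterates is used. The operator is a derivation, so it preserves a family of nonnegative functions
  closed under sums and products as soon as it maps the generators into that family; only these need
  explicit computation. The spectral gap is proved by integrating the divergence of an explicit
  vector field, first for test functions and then by density, without spectral theory.\<close>

lemma has_real_derivative_of_quadratic_bound:
  fixes f :: "real \<Rightarrow> real"
  assumes "0 < \<delta>"
    and bound: "\<And>h. \<bar>h\<bar> \<le> \<delta> \<Longrightarrow> \<bar>f (x + h) - f x - h * D\<bar> \<le> C * h\<^sup>2"
  shows "(f has_real_derivative D) (at x)"
proof -
  have "((\<lambda>h. (f (x + h) - f x) / h - D) \<longlongrightarrow> 0) (at 0)"
  proof (rule Lim_null_comparison)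
    have "\<bar>(f (x + h) - f x) / h - D\<bar> \<le> \<bar>C\<bar> * \<bar>h\<bar>" if "h \<noteq> 0" "\<bar>h\<bar> < \<delta>" for h
    proof -
      have "(f (x + h) - f x) / h - D = (f (x + h) - f x - h * D) / h"
        using that by (simp add: field_simps)
      also have "\<bar>\<dots>\<bar> \<le> (C * h\<^sup>2) / \<bar>h\<bar>"
        using bound[of h] that by (simp add: abs_divide divide_right_mono)
      also have "\<dots> = C * \<bar>h\<bar>"
        using that by (simp add: power2_eq_square abs_if)
      also have "\<dots> \<le> \<bar>C\<bar> * \<bar>h\<bar>"
        by (intro mult_right_mono) auto
      finally show ?thesis .
    qed
    then show "\<forall>\<^sub>F h in at 0. norm ((f (x + h) - f x) / h - D) \<le> \<bar>C\<bar> * \<bar>h\<bar>"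
      using \<open>0 < \<delta>\<close> by (auto simp: eventually_at dist_real_def intro!: exI[of _ \<delta>])
    show "((\<lambda>h. \<bar>C\<bar> * \<bar>h\<bar>) \<longlongrightarrow> 0) (at 0)"
      by (auto intro!: tendsto_eq_intros)
  qed
  then show ?thesis
    by (simp add: DERIV_def LIM_zero_iff)
qed

lemma exp_linear_error_le:
  fixes y :: real
  shows "\<bar>exp y - 1 - y\<bar> \<le> y\<^sup>2 * exp \<bar>y\<bar>"
proof -
  obtain t where t: "\<bar>t\<bar> \<le> \<bar>y\<bar>" "exp y = (\<Sum>m<2. y ^ m / fact m) + (exp t / fact 2) * y ^ 2"
    using Maclaurin_exp_le[of y 2] by blast
  have "exp y - 1 - y = exp t / 2 * y\<^sup>2"
    using t(2) by (simp add: numeral_2_eq_2)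
  moreover have "exp t / 2 \<le> exp \<bar>y\<bar>"
    using t(1) exp_le_cancel_iff[of t "\<bar>y\<bar>"] exp_gt_zero[of t] by linarith
  ultimately show ?thesis
    using mult_right_mono[of "exp t / 2" "exp \<bar>y\<bar>" "y\<^sup>2"]
    by (metis abs_of_nonneg exp_ge_zero half_gt_zero_iff less_imp_le exp_gt_zero mult.commute mult_nonneg_nonneg zero_le_power2)
qed

section \<open>Modified Bessel functions: decay, derivative and recurrence\<close>

definition bessel_integrand :: "real \<Rightarrow> real \<Rightarrow> real \<Rightarrow> real" where
  "bessel_integrand \<nu> x t = exp (- x * cosh t) * cosh (\<nu> * t)"

lemma bessel_integrand_measurable [measurable]:
  "bessel_integrand \<nu> x \<in> borel_measurable borel"
  unfolding bessel_integrand_def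
  by (intro borel_measurable_continuous_onI continuous_intros)

lemma bessel_integrand_nonneg: "0 \<le> bessel_integrand \<nu> x t"
  by (simp add: bessel_integrand_def cosh_real_nonneg)

text \<open>The doubly exponential decay is needed only as a power of \<open>exp t\<close>. With
  \<open>y = x * exp t / (2 * n)\<close>, the inequality \<open>exp y \<ge> y\<close> gives
  \<open>exp (- n * y) \<le> inverse (y ^ n)\<close>, a multiple of \<open>exp (- n * t)\<close>.
  Since \<open>n \<ge> \<bar>\<nu>\<bar> + 1\<close>, a factor \<open>exp (- t)\<close> survives the
  growth of \<open>cosh (\<nu> * t)\<close>.\<close>

lemma bessel_integrand_bound:
  assumes "0 < x"
  obtains C where "\<And>t. 0 \<le> t \<Longrightarrow> bessel_integrand \<nu> x t \<le> C * exp (- t)"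
proof -
  obtain n :: nat where n: "\<bar>\<nu>\<bar> + 1 \<le> real n"
    using real_arch_simple by blast
  then have "0 < real n" by linarith
  define C where "C = (2 * real n / x) ^ n"
  have "bessel_integrand \<nu> x t \<le> C * exp (- t)" if "0 \<le> t" for t
  proof -
    define y where "y = x * (exp t / 2) / real n"
    have "0 < y"
      using assms \<open>0 < real n\<close> by (simp add: y_def)
    have "x * (exp t / 2) \<le> x * cosh t"
      using assms by (intro mult_left_mono) (auto simp: cosh_def)
    then have "exp (- x * cosh t) \<le> exp (- (real n * y))"
      using \<open>0 < real n\<close> by (simp add: y_def)
    also have "\<dots> = inverse (exp y ^ n)"
      by (simp add: exp_minus exp_of_nat_mult)
    also have "\<dots> \<le> inverse (y ^ n)"
      using \<open>0 < y\<close> exp_ge_add_one_self[of y]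
      by (intro le_imp_inverse_le power_mono zero_less_power) linarith+
    also have "\<dots> = C * exp (- (real n * t))"
    proof -
      have "exp (- (real n * t)) = inverse (exp t ^ n)"
        by (simp add: exp_minus exp_of_nat_mult)
      then show ?thesis
        using assms by (simp add: C_def y_def power_mult_distrib power_divide field_simps)
    qed
    finally have e': "exp (- x * cosh t) \<le> C * exp (- (real n * t))" .
    have "cosh (\<nu> * t) \<le> exp (\<bar>\<nu>\<bar> * t)"
    proof -
      have "\<nu> * t \<le> \<bar>\<nu>\<bar> * t" "- (\<nu> * t) \<le> \<bar>\<nu>\<bar> * t"
        using that mult_right_mono[of "\<nu>" "\<bar>\<nu>\<bar>" t] mult_right_mono[of "-\<nu>" "\<bar>\<nu>\<bar>" t] by auto
      then have "exp (\<nu> * t) \<le> exp (\<bar>\<nu>\<bar> * t)" "exp (- (\<nu> * t)) \<le> exp (\<bar>\<nu>\<bar> * t)"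
        by simp_all
      then show ?thesis
        unfolding cosh_field_def by (metis add_mono field_sum_of_halves divide_right_mono add_divide_distrib zero_le_numeral)
    qed
    then have "bessel_integrand \<nu> x t \<le> (C * exp (- (real n * t))) * exp (\<bar>\<nu>\<bar> * t)"
      unfolding bessel_integrand_def using e' by (intro mult_mono) (auto simp: cosh_real_nonneg C_def assms less_imp_le)
    also have "\<dots> = C * exp (- (real n * t) + \<bar>\<nu>\<bar> * t)"
      by (simp only: exp_add mult.assoc)
    also have "\<dots> \<le> C * exp (- t)"
      using mult_right_mono[OF n that] assms by (intro mult_left_mono) (auto simp: C_def algebra_simps)
    finally show ?thesis .
  qed
  then show ?thesis
    using that by blast
qed

lemma integrable_exp_minus_Ioi: "set_integrable lborel {0<..} (\<lambda>t::real. exp (- t))"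
proof -
  have "set_integrable lborel (einterval 0 \<infinity>) (\<lambda>t. exp (- t))"
  proof (rule interval_integral_FTC_nonneg(1)[where F = "\<lambda>t. - exp (- t)" and A = "-1" and B = 0])
    show "(((\<lambda>t. - exp (- t)) \<circ> real_of_ereal) \<longlongrightarrow> 0) (at_left \<infinity>)"
      using tendsto_minus[OF filterlim_compose[OF exp_at_bot filterlim_uminus_at_bot_at_top]]
      by (simp add: ereal_tendsto_simps1)
    show "(((\<lambda>t. - exp (- t)) \<circ> real_of_ereal) \<longlongrightarrow> - 1) (at_right 0)"
      unfolding zero_ereal_def by (auto simp: ereal_tendsto_simps1 intro!: tendsto_eq_intros)
  qed (auto intro!: derivative_eq_intros continuous_intros)
  moreover have "einterval 0 \<infinity> = {0<..}"
    by (auto simp: einterval_def)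
  ultimately show ?thesis by simp
qed

lemma bessel_integrand_integrable:
  assumes "0 < x"
  shows "set_integrable lborel {0<..} (bessel_integrand \<nu> x)"
proof -
  obtain C where C: "\<And>t. 0 \<le> t \<Longrightarrow> bessel_integrand \<nu> x t \<le> C * exp (- t)"
    using bessel_integrand_bound[OF assms] by blast
  show ?thesis
    unfolding set_integrable_def
  proof (rule Bochner_Integration.integrable_bound)
    show "integrable lborel (\<lambda>t. C * (indicator {0<..} t *\<^sub>R exp (- t)))"
      using integrable_exp_minus_Ioi by (auto simp: set_integrable_def)
  qed (use C bessel_integrand_nonneg in \<open>auto simp: indicator_def intro!: AE_I2 intro: order_trans[OF C abs_ge_self]\<close>)
qed

lemma bessel_K_eq: "bessel_K \<nu> x = (LINT t:{0<..}|lborel. bessel_integrand \<nu> x t)"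
  by (simp add: bessel_K_def bessel_integrand_def)

lemma bessel_K_nonneg: "0 \<le> bessel_K \<nu> x"
  unfolding bessel_K_eq set_lebesgue_integral_def
  by (intro integral_nonneg_AE) (auto simp: bessel_integrand_nonneg)

lemma cosh_mult_cosh: "cosh a * cosh (b::real) = (cosh (b + a) + cosh (b - a)) / 2"
  by (simp add: cosh_add cosh_diff)

lemma sinh_mult_sinh: "sinh a * sinh (b::real) = (cosh (b + a) - cosh (b - a)) / 2"
  by (simp add: cosh_add cosh_diff)

lemma cosh_times_bessel_integrand:
  "cosh t * bessel_integrand \<nu> x t = (bessel_integrand (\<nu> + 1) x t + bessel_integrand (\<nu> - 1) x t) / 2"
proof -
  have "(\<nu> + 1) * t = \<nu> * t + t" "(\<nu> - 1) * t = \<nu> * t - t"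
    by (simp_all add: algebra_simps)
  then show ?thesis
    using cosh_mult_cosh[of t "\<nu> * t"]
    unfolding bessel_integrand_def mult.left_commute[of "cosh t"] by (simp flip: distrib_left)
qed

text \<open>Differentiation under the integral sign: the first-order Taylor remainder of the
  integrand is at most \<open>h\<^sup>2\<close> times one fixed integrable function, and integrating
  this bound gives a quadratic error for \<open>bessel_K\<close>. The factor \<open>cosh t\<close>
  produced by differentiation is absorbed by shifting the order by one in both directions.\<close>

lemma bessel_K_has_derivative:
  assumes "0 < x"
  shows "(bessel_K \<nu> has_real_derivative - (bessel_K (\<nu> + 1) x + bessel_K (\<nu> - 1) x) / 2) (at x)"
proof -
  define b where "b \<mu> y t = indicator {0<..} t *\<^sub>R bessel_integrand \<mu> y t" for \<mu> y t
  have int: "integrable lborel (b \<mu> y)" if "0 < y" for \<mu> y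
    using bessel_integrand_integrable[OF that] unfolding b_def[abs_def] set_integrable_def .
  have K: "bessel_K \<mu> y = integral\<^sup>L lborel (b \<mu> y)" for \<mu> y
    unfolding bessel_K_eq b_def[abs_def] set_lebesgue_integral_def ..
  have cosh_b: "cosh t * b \<mu> y t = (b (\<mu> + 1) y t + b (\<mu> - 1) y t) / 2" for \<mu> y t
    using cosh_times_bessel_integrand[of t \<mu> y] by (auto simp: b_def indicator_def)
  \<comment> \<open>The dominating function. The remainder of the exponential contributes
    \<open>(h * cosh t)\<^sup>2\<close> and a growth of at most \<open>exp (x / 2 * cosh t)\<close>,
    which uses up half of the decay; hence the argument \<open>x / 2\<close>. Absorbing
    \<open>cosh t\<close> twice turns \<open>E\<close> into a combination of integrands of shifted
    orders.\<close>
  define E where "E t = (cosh t)\<^sup>2 * b \<nu> (x / 2) t" for t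
  have "E = (\<lambda>t. (b (\<nu> + 1 + 1) (x/2) t + b (\<nu> + 1 - 1) (x/2) t + b (\<nu> - 1 + 1) (x/2) t + b (\<nu> - 1 - 1) (x/2) t) / 4)"
  proof
    fix t
    have "E t = (cosh t * b (\<nu> + 1) (x/2) t + cosh t * b (\<nu> - 1) (x/2) t) / 2"
      using cosh_b[of t \<nu> "x/2"] unfolding E_def power2_eq_square mult.assoc by (simp add: algebra_simps add_divide_distrib)
    then show "E t = (b (\<nu> + 1 + 1) (x/2) t + b (\<nu> + 1 - 1) (x/2) t + b (\<nu> - 1 + 1) (x/2) t + b (\<nu> - 1 - 1) (x/2) t) / 4"
      unfolding cosh_b by (simp add: field_simps)
  qed
  then have intE: "integrable lborel E"
    using int[of "x/2"] assms by (auto intro!: Bochner_Integration.integrable_add)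
  show ?thesis
  proof (rule has_real_derivative_of_quadratic_bound[where \<delta> = "x / 2" and C = "integral\<^sup>L lborel E"])
    fix h :: real
    assume h: "\<bar>h\<bar> \<le> x / 2"
    then have xh: "0 < x + h"
      using assms by linarith
    define R where "R t = b \<nu> (x + h) t - b \<nu> x t + h * ((b (\<nu> + 1) x t + b (\<nu> - 1) x t) / 2)" for t
    have intR: "integrable lborel R"
      unfolding R_def using int assms xh by auto
    have "\<bar>R t\<bar> \<le> h\<^sup>2 * E t" for t
    proof (cases "0 < t")
      case True
      have b: "b \<nu> y t = exp (- y * cosh t) * cosh (\<nu> * t)" for y
        using True by (simp add: b_def bessel_integrand_def)
      define y where "y = - h * cosh t"
      have "R t = b \<nu> x t * (exp y - 1 - y)"
        unfolding R_def cosh_b[symmetric] b y_def by (simp add: algebra_simps flip: exp_add)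
      then have "\<bar>R t\<bar> \<le> b \<nu> x t * (y\<^sup>2 * exp \<bar>y\<bar>)"
        using exp_linear_error_le[of y] by (simp add: b abs_mult cosh_real_nonneg mult_left_mono)
      also have "\<dots> \<le> b \<nu> x t * (y\<^sup>2 * exp (x / 2 * cosh t))"
        using h by (intro mult_left_mono) (auto simp: b y_def abs_mult cosh_real_nonneg mult_right_mono)
      also have "\<dots> = h\<^sup>2 * E t"
      proof -
        have "exp (- x * cosh t) * exp (x / 2 * cosh t) = exp (- (x/2) * cosh t)"
          by (simp flip: exp_add)
        then show ?thesis
          unfolding E_def b y_def by (simp add: power_mult_distrib mult_ac)
      qed
      finally show ?thesis .
    qed (simp add: R_def E_def b_def)
    then have "\<bar>integral\<^sup>L lborel R\<bar> \<le> integral\<^sup>L lborel (\<lambda>t. h\<^sup>2 * E t)"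
      using intR intE by (intro integral_abs_bound[THEN order_trans] integral_mono) auto
    also have "integral\<^sup>L lborel R = bessel_K \<nu> (x + h) - bessel_K \<nu> x + h * ((bessel_K (\<nu> + 1) x + bessel_K (\<nu> - 1) x) / 2)"
      unfolding R_def K using int assms xh by simp
    finally show "\<bar>bessel_K \<nu> (x + h) - bessel_K \<nu> x - h * (- (bessel_K (\<nu> + 1) x + bessel_K (\<nu> - 1) x) / 2)\<bar>
        \<le> integral\<^sup>L lborel E * h\<^sup>2"
      by (simp add: mult.commute diff_divide_distrib add_divide_distrib ring_distribs diff_diff_eq add.assoc)
  qed (use assms in auto)
qed

text \<open>Integration by parts: the difference of the two integrands is the derivative of
  \<open>exp (- x * cosh t) * sinh (\<nu> * t)\<close>, which vanishes both at \<open>0\<close> and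
  at infinity.\<close>

lemma bessel_K_recurrence:
  assumes "0 < x"
  shows "\<nu> * bessel_K \<nu> x = x / 2 * (bessel_K (\<nu> + 1) x - bessel_K (\<nu> - 1) x)"
proof -
  define f where "f t = \<nu> * bessel_integrand \<nu> x t -
    x / 2 * (bessel_integrand (\<nu> + 1) x t - bessel_integrand (\<nu> - 1) x t)" for t
  define F where "F t = exp (- x * cosh t) * sinh (\<nu> * t)" for t
  have i: "einterval 0 \<infinity> = {0<..}"
    by (auto simp: einterval_def)
  have deriv: "(F has_real_derivative f t) (at t)" for t
  proof -
    have eq: "x * sinh t * sinh (\<nu> * t) = x / 2 * (cosh ((\<nu> + 1) * t) - cosh ((\<nu> - 1) * t))"
      using arg_cong[OF sinh_mult_sinh[of t "\<nu> * t"], of "(*) x"] by (simp add: ring_distribs)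
    have "f t = exp (- x * cosh t) * (\<nu> * cosh (\<nu> * t) - x * sinh t * sinh (\<nu> * t))"
      unfolding eq f_def bessel_integrand_def by (simp add: algebra_simps)
    moreover have "(F has_real_derivative exp (- x * cosh t) * (\<nu> * cosh (\<nu> * t) - x * sinh t * sinh (\<nu> * t))) (at t)"
      unfolding F_def by (auto intro!: derivative_eq_intros simp: algebra_simps)
    ultimately show ?thesis by simp
  qed
  have setint: "set_integrable lborel {0<..} f"
    unfolding f_def using bessel_integrand_integrable[OF assms]
    by (intro set_integral_diff set_integrable_mult_right) auto
  obtain C where C: "\<And>t. 0 \<le> t \<Longrightarrow> bessel_integrand \<nu> x t \<le> C * exp (- t)"
    using bessel_integrand_bound[OF assms] by blast
  have F_top: "(F \<longlongrightarrow> 0) at_top"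
  proof (rule Lim_null_comparison)
    have "\<bar>F t\<bar> \<le> C * exp (- t)" if "0 \<le> t" for t
    proof -
      have "\<bar>sinh (\<nu> * t)\<bar> \<le> cosh (\<nu> * t)"
        using cosh_minus_sinh[of "\<nu> * t"] cosh_plus_sinh[of "\<nu> * t"]
          exp_gt_zero[of "\<nu> * t"] exp_gt_zero[of "- (\<nu> * t)"] by linarith
      then have "\<bar>F t\<bar> \<le> bessel_integrand \<nu> x t"
        by (simp add: F_def bessel_integrand_def abs_mult)
      with C[OF that] show ?thesis by linarith
    qed
    then show "\<forall>\<^sub>F t in at_top. norm (F t) \<le> C * exp (- t)"
      by (auto simp: eventually_at_top_linorder)
    show "((\<lambda>t. C * exp (- t)) \<longlongrightarrow> 0) at_top"
      by (auto intro!: tendsto_mult_right_zero filterlim_compose[OF exp_at_bot filterlim_uminus_at_bot_at_top])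
  qed
  have "(LBINT t=0..\<infinity>. f t) = 0 - 0"
  proof (rule interval_integral_FTC_integrable[where F = F])
    show "((F \<circ> real_of_ereal) \<longlongrightarrow> 0) (at_left \<infinity>)"
      using F_top by (simp add: ereal_tendsto_simps1)
    have "isCont F 0"
      unfolding F_def by (intro continuous_intros)
    then have "(F \<longlongrightarrow> 0) (at 0)"
      by (simp add: isCont_def F_def)
    then show "((F \<circ> real_of_ereal) \<longlongrightarrow> 0) (at_right 0)"
      unfolding zero_ereal_def by (simp add: ereal_tendsto_simps1 filterlim_at_split)
    show "isCont f t" for t
      unfolding f_def bessel_integrand_def by (intro continuous_intros)
  qed (use deriv setint in \<open>auto simp: i has_real_derivative_iff_has_vector_derivative[symmetric]\<close>)
  then have "(LINT t:{0<..}|lborel. f t) = 0"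
    by (simp add: interval_lebesgue_integral_def i)
  moreover have "(LINT t:{0<..}|lborel. f t) =
      \<nu> * bessel_K \<nu> x - x / 2 * (bessel_K (\<nu> + 1) x - bessel_K (\<nu> - 1) x)"
    unfolding f_def bessel_K_eq
    using bessel_integrand_integrable[OF assms] by (simp add: set_integral_diff)
  ultimately show ?thesis by simp
qed

text \<open>Numerators in \<open>(- (sinh r)\<^sup>-\<^sup>1 d/dr)\<^sup>k (r / sinh r) = rsinh_num k r / (sinh r)\<^bsup>2 k + 1\<^esup>\<close>. They vanish
  at \<open>0\<close>, and each is increasing because its derivative is a positive multiple of its predecessor.\<close>

fun rsinh_num :: "nat \<Rightarrow> real \<Rightarrow> real" where
  "rsinh_num 0 r = r"
| "rsinh_num (Suc 0) r = cosh r * r - sinh r"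
| "rsinh_num (Suc (Suc k)) r =
     (2 * real k + 3) * cosh r * rsinh_num (Suc k) r - (real k + 1)\<^sup>2 * (sinh r)\<^sup>2 * rsinh_num k r"

lemma rsinh_num_eq:
  "rsinh_num 0 = (\<lambda>r. r)"
  "rsinh_num (Suc 0) = (\<lambda>r. cosh r * r - sinh r)"
  "rsinh_num (Suc (Suc k)) = (\<lambda>r. (2 * real k + 3) * cosh r * rsinh_num (Suc k) r
      - (real k + 1)\<^sup>2 * (sinh r)\<^sup>2 * rsinh_num k r)"
  by auto

lemma rsinh_num_has_derivative:
  "(rsinh_num 0 has_real_derivative 1) (at r)"
  "(rsinh_num (Suc k) has_real_derivative (real k + 1)\<^sup>2 * sinh r * rsinh_num k r) (at r)"
proof -
  show 0: "(rsinh_num 0 has_real_derivative 1) (at r)" for r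
    by (simp add: rsinh_num_eq(1))
  show "(rsinh_num (Suc k) has_real_derivative (real k + 1)\<^sup>2 * sinh r * rsinh_num k r) (at r)"
  proof (induction k arbitrary: r rule: induct_nat_012)
    case 0
    show ?case
      unfolding rsinh_num_eq by (auto intro!: derivative_eq_intros)
  next
    case 1
    have "((\<lambda>r. 3 * cosh r * (cosh r * r - sinh r) - (sinh r)\<^sup>2 * r) has_real_derivative
        3 * (sinh r * (cosh r * r - sinh r) + cosh r * (sinh r * r)) - (2 * sinh r * cosh r * r + (sinh r)\<^sup>2)) (at r)"
      by (rule derivative_eq_intros refl)+ (simp add: power2_eq_square algebra_simps)
    also have "3 * (sinh r * (cosh r * r - sinh r) + cosh r * (sinh r * r)) - (2 * sinh r * cosh r * r + (sinh r)\<^sup>2)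
        = 4 * sinh r * (cosh r * r - sinh r)"
      by (simp add: power2_eq_square algebra_simps)
    finally show ?case
      by (simp add: rsinh_num_eq)
  next
    case (ge2 k)
    have rec: "rsinh_num (Suc (Suc (Suc k))) = (\<lambda>r. (2 * real k + 5) * cosh r * rsinh_num (Suc (Suc k)) r
        - (real k + 2)\<^sup>2 * (sinh r)\<^sup>2 * rsinh_num (Suc k) r)"
      unfolding fun_eq_iff rsinh_num.simps(3)[of "Suc k"] by (simp only: of_nat_Suc) (simp add: add_ac)
    have prod: "((\<lambda>r. (2 * real k + 5) * cosh r * P r - (real k + 2)\<^sup>2 * (sinh r)\<^sup>2 * Q r) has_real_derivative
        (2 * real k + 5) * (sinh r * P r + cosh r * dP)
        - (real k + 2)\<^sup>2 * (2 * sinh r * cosh r * Q r + (sinh r)\<^sup>2 * dQ)) (at r)"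
      if "(P has_real_derivative dP) (at r)" "(Q has_real_derivative dQ) (at r)" for P Q dP dQ
      by (rule derivative_eq_intros that refl)+ (simp add: power2_eq_square algebra_simps)
    define p2 p1 p0 where "p2 = rsinh_num (Suc (Suc k)) r" and "p1 = rsinh_num (Suc k) r" and "p0 = rsinh_num k r"
    have p2: "p2 = (2 * real k + 3) * cosh r * p1 - (real k + 1)\<^sup>2 * (sinh r)\<^sup>2 * p0"
      by (simp add: p2_def p1_def p0_def)
    \<comment> \<open>Once \<open>(k + 2)\<^sup>2 * sinh r\<close> is factored out, the terms in
      \<open>p1\<close> and \<open>p0\<close> add up to \<open>p2\<close> by the recurrence, and
      \<open>(2 * k + 5) + (k + 2)\<^sup>2 = (k + 3)\<^sup>2\<close>.\<close>
    have eq: "(2 * real k + 5) * (sinh r * p2 + cosh r * ((real k + 2)\<^sup>2 * sinh r * p1))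
        - (real k + 2)\<^sup>2 * (2 * sinh r * cosh r * p1 + (sinh r)\<^sup>2 * ((real k + 1)\<^sup>2 * sinh r * p0))
        = (real k + 3)\<^sup>2 * sinh r * p2"
      unfolding p2 by (simp add: power2_eq_square algebra_simps)
    have Suc: "real (Suc k) + 1 = real k + 2" "real (Suc (Suc k)) + 1 = real k + 3"
      by simp_all
    show ?case
      unfolding rec Suc
      by (rule DERIV_cong[OF prod[OF ge2(2,1), unfolded Suc]]) (rule eq[unfolded p2_def p1_def p0_def])
  qed
qed

lemma rsinh_num_nonneg: "0 \<le> r \<Longrightarrow> 0 \<le> rsinh_num k r"
proof (induction k arbitrary: r)
  case (Suc k)
  have "rsinh_num (Suc k) 0 \<le> rsinh_num (Suc k) r"
  proof (rule DERIV_nonneg_imp_nondecreasing[OF Suc.prems])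
    fix t :: real
    assume "0 \<le> t" "t \<le> r"
    then have "0 \<le> (real k + 1)\<^sup>2 * sinh t * rsinh_num k t"
      using Suc.IH by simp
    then show "\<exists>y. (rsinh_num (Suc k) has_real_derivative y) (at t) \<and> 0 \<le> y"
      using rsinh_num_has_derivative(2) by blast
  qed
  moreover have "rsinh_num (Suc k) 0 = 0"
    by (induction k rule: induct_nat_012) simp_all
  ultimately show ?case by simp
qed simp

text \<open>The quotient rule for \<open>rsinh\<close> produces the successor of the numerator in
  this first-order form; the derivative formula reconciles it with the defining three-term
  recurrence.\<close>

lemma rsinh_num_Suc:
  "rsinh_num (Suc k) r = (2 * real k + 1) * cosh r * rsinh_num k r - sinh r * deriv (rsinh_num k) r"
proof (cases k)
  case 0
  then show ?thesis
    using DERIV_imp_deriv[OF rsinh_num_has_derivative(1)[of r]] by simp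
next
  case (Suc j)
  then show ?thesis
    using DERIV_imp_deriv[OF rsinh_num_has_derivative(2)[of j r]]
    by (simp add: power2_eq_square algebra_simps)
qed

definition rsinh :: "nat \<Rightarrow> real \<Rightarrow> real" where
  "rsinh k r = rsinh_num k r / sinh r ^ (2 * k + 1)"

lemma rsinh_has_derivative:
  assumes "0 < r"
  shows "(rsinh k has_real_derivative - sinh r * rsinh (Suc k) r) (at r)"
proof -
  have s: "sinh r > 0" using assms by simp
  obtain D where D: "(rsinh_num k has_real_derivative D) (at r)"
    using rsinh_num_has_derivative(1)[of r] rsinh_num_has_derivative(2)[of "k - 1" r] by (cases k) auto
  have "(rsinh k has_real_derivative
      (D * sinh r ^ (2 * k + 1) - rsinh_num k r * (real (2 * k + 1) * sinh r ^ (2 * k) * cosh r))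
        / (sinh r ^ (2 * k + 1) * sinh r ^ (2 * k + 1))) (at r)"
  proof -
    have "((\<lambda>r. sinh r ^ (2 * k + 1)) has_real_derivative real (2 * k + 1) * sinh r ^ (2 * k) * cosh r) (at r)"
      by (rule derivative_eq_intros refl)+ simp
    from DERIV_divide[OF D this] s show ?thesis
      unfolding rsinh_def[abs_def] by simp
  qed
  moreover have "(D * sinh r ^ (2 * k + 1) - rsinh_num k r * (real (2 * k + 1) * sinh r ^ (2 * k) * cosh r))
        / (sinh r ^ (2 * k + 1) * sinh r ^ (2 * k + 1)) = - sinh r * rsinh (Suc k) r"
  proof -
    define z p where "z = sinh r" and "p = z ^ (2 * k)"
    have pow: "sinh r ^ (2 * k) = p" "sinh r ^ (2 * k + 1) = z * p" "sinh r ^ (2 * Suc k + 1) = z * z * z * p"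
      by (simp_all add: z_def p_def power_add)
    have "z \<noteq> 0" "p \<noteq> 0"
      using s by (simp_all add: z_def p_def)
    then have "(D * (z * p) - q * (m * p * c)) / (z * p * (z * p)) = - z * ((m * c * q - z * D) / (z * z * z * p))" for q m c
      by (simp add: divide_simps) (simp add: algebra_simps)
    from this[of "rsinh_num k r" "real (2 * k + 1)" "cosh r"] show ?thesis
      unfolding rsinh_def rsinh_num_Suc DERIV_imp_deriv[OF D] pow by (simp add: z_def)
  qed
  ultimately show ?thesis by simp
qed

text \<open>The profile in the kernel has \<open>a = (N - 1) / 2\<close> and
  \<open>\<nu> = (1 + 2 * s) / 2\<close>. The order is kept free because each application of the
  radial operator raises it by one.\<close>

definition scaled_bessel :: "real \<Rightarrow> real \<Rightarrow> real \<Rightarrow> real" where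
  "scaled_bessel a \<nu> r = r powr (- \<nu>) * bessel_K \<nu> (a * r)"

text \<open>The recurrence rewrites the term that comes from differentiating the power, after which
  the contributions of order \<open>\<nu> - 1\<close> cancel. The factor
  \<open>rsinh 0 r = r / sinh r\<close> arises because the power of \<open>r\<close> must match the
  new order while a factor \<open>sinh r\<close> is split off.\<close>

lemma scaled_bessel_has_derivative:
  assumes "0 < a" "0 < r"
  shows "(scaled_bessel a \<nu> has_real_derivative - sinh r * (a * (rsinh 0 r * scaled_bessel a (\<nu> + 1) r))) (at r)"
proof -
  have ar: "0 < a * r" using assms by simp
  let ?K = "\<lambda>\<mu>. bessel_K \<mu> (a * r)"
  have "((\<lambda>r. bessel_K \<nu> (a * r)) has_real_derivative - (?K (\<nu> + 1) + ?K (\<nu> - 1)) / 2 * a) (at r)"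
    using bessel_K_has_derivative[OF ar, of \<nu>] by (rule DERIV_chain2) (auto intro!: derivative_eq_intros)
  then have "(scaled_bessel a \<nu> has_real_derivative
      - \<nu> * r powr (- \<nu> - 1) * ?K \<nu> + - (?K (\<nu> + 1) + ?K (\<nu> - 1)) / 2 * a * r powr (- \<nu>)) (at r)"
    unfolding scaled_bessel_def using assms
    by (intro DERIV_mult) (auto intro!: derivative_eq_intros simp: powr_diff)
  also have "- \<nu> * r powr (- \<nu> - 1) * ?K \<nu> + - (?K (\<nu> + 1) + ?K (\<nu> - 1)) / 2 * a * r powr (- \<nu>)
      = - a * r powr (- \<nu>) * ?K (\<nu> + 1)"
  proof -
    have "- \<nu> * r powr (- \<nu> - 1) * ?K \<nu> = - (r powr (- \<nu> - 1) * (\<nu> * ?K \<nu>))"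
      by simp
    also have "\<dots> = - (r powr (- \<nu>) * a / 2 * (?K (\<nu> + 1) - ?K (\<nu> - 1)))"
      unfolding bessel_K_recurrence[OF ar] using assms by (simp add: powr_diff)
    finally have "- \<nu> * r powr (- \<nu> - 1) * ?K \<nu> = - (r powr (- \<nu>) * a / 2 * (?K (\<nu> + 1) - ?K (\<nu> - 1)))" .
    moreover have "- (P * a / 2 * (A - B)) + - (A + B) / 2 * a * P = - a * P * A" for P A B :: real
      by (simp add: field_simps)
    ultimately show ?thesis by (simp only:)
  qed
  also have "- a * r powr (- \<nu>) * ?K (\<nu> + 1) = - sinh r * (a * (rsinh 0 r * scaled_bessel a (\<nu> + 1) r))"
  proof -
    have powr: "r powr (- \<nu>) = r * r powr (- (\<nu> + 1))"
      using assms by (simp add: powr_diff)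
    have "sinh r \<noteq> 0" using assms by simp
    then have "- a * (r * P) * K = - sinh r * (a * (r / sinh r * (P * K)))" for P K
      by simp
    then show ?thesis
      unfolding powr by (simp add: rsinh_def scaled_bessel_def)
  qed
  finally show ?thesis .
qed

text \<open>A multiplicatively closed convex cone large enough to contain every iterate of the
  radial operator on the Bessel profile. Products are needed because the operator turns
  \<open>scaled_bessel\<close> into a product with \<open>rsinh 0\<close>, and further applications
  follow the Leibniz rule; all \<open>rsinh k\<close> are generators because the operator sends each
  to the next.\<close>

inductive radial_cone :: "real \<Rightarrow> (real \<Rightarrow> real) \<Rightarrow> bool" for a where
  rsinh: "radial_cone a (rsinh k)"
| bessel: "radial_cone a (scaled_bessel a \<nu>)"
| scale: "radial_cone a f \<Longrightarrow> 0 \<le> c \<Longrightarrow> radial_cone a (\<lambda>r. c * f r)"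
| add: "radial_cone a f \<Longrightarrow> radial_cone a g \<Longrightarrow> radial_cone a (\<lambda>r. f r + g r)"
| mult: "radial_cone a f \<Longrightarrow> radial_cone a g \<Longrightarrow> radial_cone a (\<lambda>r. f r * g r)"

lemma radial_cone_nonneg: "radial_cone a f \<Longrightarrow> 0 < r \<Longrightarrow> 0 \<le> f r"
proof (induction rule: radial_cone.induct)
  case (rsinh k)
  then show ?case by (simp add: rsinh_def rsinh_num_nonneg)
next
  case (bessel \<nu>)
  then show ?case by (simp add: scaled_bessel_def bessel_K_nonneg)
qed auto

lemma radial_cone_has_derivative:
  assumes "0 < a" "radial_cone a f"
  shows "\<exists>g. radial_cone a g \<and> (\<forall>r>0. (f has_real_derivative - sinh r * g r) (at r))"
  using assms(2)
proof (induction rule: radial_cone.induct)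
  case (rsinh k)
  then show ?case
    using radial_cone.rsinh[of a "Suc k"] rsinh_has_derivative by blast
next
  case (bessel \<nu>)
  have "radial_cone a (\<lambda>r. a * (rsinh 0 r * scaled_bessel a (\<nu> + 1) r))"
    using assms(1) by (intro radial_cone.intros) auto
  then show ?case
    using scaled_bessel_has_derivative[OF assms(1)] by blast
next
  case (scale f c)
  then obtain g where g: "radial_cone a g" "\<And>r. 0 < r \<Longrightarrow> (f has_real_derivative - sinh r * g r) (at r)"
    by blast
  have "((\<lambda>r. c * f r) has_real_derivative - sinh r * (c * g r)) (at r)" if "0 < r" for r
    using DERIV_cmult[OF g(2)[OF that], of c] by (simp add: mult_ac)
  with g(1) scale(2) show ?case
    by (blast intro: radial_cone.scale)
next
  case (add f1 f2)
  then obtain g1 g2 where g: "radial_cone a g1" "radial_cone a g2"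
    "\<And>r. 0 < r \<Longrightarrow> (f1 has_real_derivative - sinh r * g1 r) (at r)"
    "\<And>r. 0 < r \<Longrightarrow> (f2 has_real_derivative - sinh r * g2 r) (at r)"
    by blast
  have "((\<lambda>r. f1 r + f2 r) has_real_derivative - sinh r * (g1 r + g2 r)) (at r)" if "0 < r" for r
    using DERIV_add[OF g(3,4)[OF that]] by (simp add: algebra_simps)
  with g(1,2) show ?case
    by (blast intro: radial_cone.add)
next
  case (mult f1 f2)
  then obtain g1 g2 where g: "radial_cone a g1" "radial_cone a g2"
    "\<And>r. 0 < r \<Longrightarrow> (f1 has_real_derivative - sinh r * g1 r) (at r)"
    "\<And>r. 0 < r \<Longrightarrow> (f2 has_real_derivative - sinh r * g2 r) (at r)"
    by blast
  have "((\<lambda>r. f1 r * f2 r) has_real_derivative - sinh r * (f1 r * g2 r + g1 r * f2 r)) (at r)" if "0 < r" for r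
    using DERIV_mult[OF g(3,4)[OF that]] by (simp add: algebra_simps)
  moreover have "radial_cone a (\<lambda>r. f1 r * g2 r + g1 r * f2 r)"
    using g mult by (intro radial_cone.intros)
  ultimately show ?case
    by blast
qed

text \<open>The iterates are identified with members of the cone on the positive half-line only, so
  differentiating again needs the locality of \<open>deriv\<close>.\<close>

lemma radial_op_cong:
  assumes "0 < r" "\<And>t. 0 < t \<Longrightarrow> f t = g t"
  shows "radial_op f r = radial_op g r"
proof -
  have "\<forall>\<^sub>F t in nhds r. f t = g t"
    using assms by (auto simp: eventually_nhds intro!: exI[of _ "{0<..}"])
  then show ?thesis
    by (simp add: radial_op_def deriv_cong_ev)
qed

lemma radial_op_power_in_cone:
  assumes "0 < a" "radial_cone a f"
  shows "\<exists>g. radial_cone a g \<and> (\<forall>r>0. (radial_op ^^ k) f r = g r)"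
proof (induction k)
  case 0
  then show ?case using assms by auto
next
  case (Suc k)
  then obtain g where g: "radial_cone a g" "\<And>r. 0 < r \<Longrightarrow> (radial_op ^^ k) f r = g r"
    by blast
  obtain h where h: "radial_cone a h" "\<And>r. 0 < r \<Longrightarrow> (g has_real_derivative - sinh r * h r) (at r)"
    using radial_cone_has_derivative[OF assms(1) g(1)] by blast
  have "(radial_op ^^ Suc k) f r = h r" if "0 < r" for r
  proof -
    have "(radial_op ^^ Suc k) f r = radial_op g r"
      using radial_op_cong[OF that g(2)] by simp
    also have "\<dots> = h r"
      using DERIV_imp_deriv[OF h(2)[OF that]] that by (simp add: radial_op_def)
    finally show ?thesis .
  qed
  with h(1) show ?case by blast
qed

lemma frac_kernel_nonneg:
  assumes "2 \<le> N" "0 < s" "0 < \<rho>"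
  shows "0 \<le> frac_kernel N s \<rho>"
proof -
  define a where "a = (real N - 1) / 2"
  have "0 < a" using assms by (simp add: a_def)
  have "bessel_profile N s = scaled_bessel a ((1 + 2 * s) / 2)"
    by (auto simp: bessel_profile_def scaled_bessel_def a_def)
  then have nonneg: "0 \<le> (radial_op ^^ k) (bessel_profile N s) r" if "0 < r" for k r
    using radial_op_power_in_cone[OF \<open>0 < a\<close> radial_cone.bessel] radial_cone_nonneg that by metis
  have "0 < Gamma ((real N + 2 * s) / 2)" "0 < Gamma (3 / 2 :: real)"
    using assms by (auto intro!: Gamma_real_pos)
  then have "0 \<le> kernel_const N s"
    by (simp add: kernel_const_def)
  \<comment> \<open>The sign of the integrand decides the sign of the integral in every case: a
    Bochner integral that does not converge has the value \<open>0\<close>.\<close>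
  moreover have "0 \<le> (LINT r:{\<rho><..}|lborel. sinh r / (sqrt pi * sqrt (cosh r - cosh \<rho>)) *
           (radial_op ^^ (N div 2)) (bessel_profile N s) r)"
    unfolding set_lebesgue_integral_def
    using assms by (intro integral_nonneg_AE AE_I2)
      (auto simp: indicator_def cosh_real_nonneg_le_iff intro!: mult_nonneg_nonneg divide_nonneg_nonneg nonneg)
  ultimately show ?thesis
    using nonneg assms by (simp add: frac_kernel_def)
qed

section \<open>Square-integrable functions\<close>

definition sq_integrable :: "'a measure \<Rightarrow> ('a \<Rightarrow> 'b::euclidean_space) \<Rightarrow> bool" where
  "sq_integrable M f \<longleftrightarrow> f \<in> borel_measurable M \<and> integrable M (\<lambda>x. (norm (f x))\<^sup>2)"

text \<open>Convergence in \<open>L\<^sup>2\<close> for vector-valued functions, so that a single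
  notion covers both functions and their gradients.\<close>

definition sq_tendsto :: "'a measure \<Rightarrow> (nat \<Rightarrow> 'a \<Rightarrow> 'b::euclidean_space) \<Rightarrow> ('a \<Rightarrow> 'b) \<Rightarrow> bool" where
  "sq_tendsto M F f \<longleftrightarrow> (\<forall>n. sq_integrable M (F n)) \<and> sq_integrable M f \<and>
     (\<lambda>n. LINT x|M. (norm (F n x - f x))\<^sup>2) \<longlonglongrightarrow> 0"

lemma sq_integrableD:
  assumes "sq_integrable M f"
  shows "f \<in> borel_measurable M" "integrable M (\<lambda>x. (norm (f x))\<^sup>2)"
  using assms by (auto simp: sq_integrable_def)

lemma norm_add_sq_le: "(norm (a + b :: 'b::real_inner))\<^sup>2 \<le> 2 * (norm a)\<^sup>2 + 2 * (norm b)\<^sup>2"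
proof -
  have "0 \<le> (norm (a - b))\<^sup>2" by simp
  then show ?thesis
    by (simp add: power2_norm_eq_inner inner_simps inner_commute)
qed

lemma norm_diff_sq_le: "(norm (a - b :: 'b::real_inner))\<^sup>2 \<le> 2 * (norm a)\<^sup>2 + 2 * (norm b)\<^sup>2"
  using norm_add_sq_le[of a "- b"] by simp

lemma sq_integrable_bound:
  assumes "sq_integrable M f" "g \<in> borel_measurable M" "AE x in M. norm (g x) \<le> norm (f x)"
  shows "sq_integrable M g"
proof -
  have "integrable M (\<lambda>x. (norm (g x))\<^sup>2)"
  proof (rule Bochner_Integration.integrable_bound[OF sq_integrableD(2)[OF assms(1)]])
    show "AE x in M. norm ((norm (g x))\<^sup>2) \<le> norm ((norm (f x))\<^sup>2)"
      using assms(3) by (auto intro: power_mono)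
  qed (use assms(2) in measurable)
  with assms(2) show ?thesis by (simp add: sq_integrable_def)
qed

lemma sq_integrable_diff:
  assumes "sq_integrable M f" "sq_integrable M g"
  shows "sq_integrable M (\<lambda>x. f x - g x)"
proof -
  note [measurable] = sq_integrableD(1)[OF assms(1)] sq_integrableD(1)[OF assms(2)]
  have "integrable M (\<lambda>x. (norm (f x - g x))\<^sup>2)"
  proof (rule Bochner_Integration.integrable_bound)
    show "integrable M (\<lambda>x. 2 * (norm (f x))\<^sup>2 + 2 * (norm (g x))\<^sup>2)"
      using assms by (auto simp: sq_integrable_def)
    show "AE x in M. norm ((norm (f x - g x))\<^sup>2) \<le> norm (2 * (norm (f x))\<^sup>2 + 2 * (norm (g x))\<^sup>2)"
      using norm_diff_sq_le by auto
  qed measurable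
  then show ?thesis by (simp add: sq_integrable_def)
qed

lemma abs_inner_le_sq:
  fixes a b :: "'b::real_inner"
  assumes "0 < d"
  shows "\<bar>a \<bullet> b\<bar> \<le> (norm a)\<^sup>2 / (2 * d) + d / 2 * (norm b)\<^sup>2"
proof -
  have "0 \<le> (norm a - d * norm b)\<^sup>2 / (2 * d)"
    using assms by simp
  also have "\<dots> = (norm a)\<^sup>2 / (2 * d) + d / 2 * (norm b)\<^sup>2 - norm a * norm b"
    using assms by (simp add: power2_eq_square field_simps)
  finally show ?thesis
    using Cauchy_Schwarz_ineq2[of a b] by linarith
qed

lemma sq_integrable_inner:
  assumes "sq_integrable M f" "sq_integrable M g"
  shows "integrable M (\<lambda>x. f x \<bullet> g x)"
proof (rule Bochner_Integration.integrable_bound)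
  note [measurable] = sq_integrableD(1)[OF assms(1)] sq_integrableD(1)[OF assms(2)]
  show "integrable M (\<lambda>x. (norm (f x))\<^sup>2 / (2 * 1) + 1 / 2 * (norm (g x))\<^sup>2)"
    using assms by (auto simp: sq_integrable_def)
  show "(\<lambda>x. f x \<bullet> g x) \<in> borel_measurable M" by measurable
  show "AE x in M. norm (f x \<bullet> g x) \<le> norm ((norm (f x))\<^sup>2 / (2 * 1) + 1 / 2 * (norm (g x))\<^sup>2)"
    using abs_inner_le_sq[of 1] by (auto intro!: AE_I2 intro: order_trans[OF _ abs_ge_self])
qed

text \<open>A pointwise Young inequality whose weight depends on \<open>n\<close> takes the place of
  the Cauchy-Schwarz inequality for integrals.\<close>

lemma sq_tendsto_inner:
  assumes "sq_tendsto M F f" "sq_integrable M g"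
  shows "(\<lambda>n. LINT x|M. F n x \<bullet> g x) \<longlonglongrightarrow> (LINT x|M. f x \<bullet> g x)"
proof -
  define a where "a n = (LINT x|M. (norm (F n x - f x))\<^sup>2)" for n
  \<comment> \<open>The weight is chosen so that \<open>a n \<le> (d n)\<^sup>2\<close> and
    \<open>d n\<close> tends to \<open>0\<close>, which makes both Young terms of size
    \<open>d n\<close>; the summand \<open>1 / real (Suc n)\<close> keeps it positive when
    \<open>a n = 0\<close>.\<close>
  define d where "d n = sqrt (a n + 1 / real (Suc n))" for n
  define G where "G = (LINT x|M. (norm (g x))\<^sup>2)"
  have a: "a \<longlonglongrightarrow> 0" "0 \<le> a n" for n
    using assms(1) by (auto simp: sq_tendsto_def a_def[abs_def])
  have d_pos: "0 < d n" for n
    using a(2)[of n] by (simp add: d_def add_nonneg_pos)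
  have "d \<longlonglongrightarrow> sqrt (0 + 0)"
    unfolding d_def by (intro tendsto_intros a(1) LIMSEQ_Suc lim_1_over_n)
  then have d0: "d \<longlonglongrightarrow> 0" by simp
  have diff: "sq_integrable M (\<lambda>x. F n x - f x)" for n
    using assms(1) by (auto simp: sq_tendsto_def intro: sq_integrable_diff)
  have "(\<lambda>n. (LINT x|M. F n x \<bullet> g x) - (LINT x|M. f x \<bullet> g x)) \<longlonglongrightarrow> 0"
  proof (rule Lim_null_comparison)
    show "\<forall>\<^sub>F n in sequentially. norm ((LINT x|M. F n x \<bullet> g x) - (LINT x|M. f x \<bullet> g x)) \<le> d n / 2 * (1 + G)"
    proof (rule always_eventually, rule allI)
      fix n
      have "(LINT x|M. F n x \<bullet> g x) - (LINT x|M. f x \<bullet> g x) = (LINT x|M. (F n x - f x) \<bullet> g x)"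
        using assms by (simp add: inner_diff_left sq_integrable_inner sq_tendsto_def)
      also have "norm \<dots> \<le> (LINT x|M. (norm (F n x - f x))\<^sup>2 / (2 * d n) + d n / 2 * (norm (g x))\<^sup>2)"
      proof (rule order_trans[OF integral_norm_bound integral_mono])
        show "integrable M (\<lambda>x. norm ((F n x - f x) \<bullet> g x))"
          using sq_integrable_inner[OF diff assms(2)] by simp
        show "integrable M (\<lambda>x. (norm (F n x - f x))\<^sup>2 / (2 * d n) + d n / 2 * (norm (g x))\<^sup>2)"
          using sq_integrableD(2)[OF diff] sq_integrableD(2)[OF assms(2)] by auto
      qed (use abs_inner_le_sq[OF d_pos] in auto)
      also have "\<dots> = a n / (2 * d n) + d n / 2 * G"
        using sq_integrableD(2)[OF diff] sq_integrableD(2)[OF assms(2)] by (simp add: a_def G_def)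
      also have "a n / (2 * d n) \<le> d n / 2"
      proof -
        have "a n \<le> (d n)\<^sup>2"
          using a(2)[of n] by (simp add: d_def)
        then show ?thesis
          using d_pos[of n] by (simp add: field_simps power2_eq_square)
      qed
      finally show "norm ((LINT x|M. F n x \<bullet> g x) - (LINT x|M. f x \<bullet> g x)) \<le> d n / 2 * (1 + G)"
        by (simp add: algebra_simps)
    qed
    show "(\<lambda>n. d n / 2 * (1 + G)) \<longlonglongrightarrow> 0"
      using tendsto_mult[OF tendsto_divide[OF d0 tendsto_const[of 2]] tendsto_const[of "1 + G"]] by simp
  qed
  then show ?thesis
    by (simp add: LIM_zero_iff)
qed

lemma sq_tendsto_norm:
  assumes "sq_tendsto M F f"
  shows "(\<lambda>n. LINT x|M. (norm (F n x))\<^sup>2) \<longlonglongrightarrow> (LINT x|M. (norm (f x))\<^sup>2)"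
proof -
  have F: "sq_integrable M (F n)" and f: "sq_integrable M f" and diff: "sq_integrable M (\<lambda>x. F n x - f x)" for n
    using assms by (auto simp: sq_tendsto_def intro: sq_integrable_diff)
  have "(norm (F n x))\<^sup>2 = (norm (F n x - f x))\<^sup>2 + 2 * (F n x \<bullet> f x) - (norm (f x))\<^sup>2" for n x
    by (simp add: power2_norm_eq_inner inner_simps inner_commute)
  then have "(LINT x|M. (norm (F n x))\<^sup>2) =
      (LINT x|M. (norm (F n x - f x))\<^sup>2) + 2 * (LINT x|M. F n x \<bullet> f x) - (LINT x|M. (norm (f x))\<^sup>2)" for n
    using sq_integrableD(2)[OF diff] sq_integrableD(2)[OF f] sq_integrable_inner[OF F f] by simp
  moreover have "(\<lambda>n. (LINT x|M. (norm (F n x - f x))\<^sup>2) + 2 * (LINT x|M. F n x \<bullet> f x) - (LINT x|M. (norm (f x))\<^sup>2))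
      \<longlonglongrightarrow> 0 + 2 * (LINT x|M. f x \<bullet> f x) - (LINT x|M. (norm (f x))\<^sup>2)"
    using assms by (intro tendsto_intros sq_tendsto_inner f) (auto simp: sq_tendsto_def)
  ultimately show ?thesis
    by (simp add: power2_norm_eq_inner)
qed

lemma sq_tendsto_diff:
  assumes "sq_tendsto M F f" "sq_tendsto M G g"
  shows "sq_tendsto M (\<lambda>n x. F n x - G n x) (\<lambda>x. f x - g x)"
proof -
  have F: "sq_integrable M (F n)" "sq_integrable M (\<lambda>x. F n x - f x)" and G: "sq_integrable M (G n)" "sq_integrable M (\<lambda>x. G n x - g x)"
    and f: "sq_integrable M f" and g: "sq_integrable M g" for n
    using assms by (auto simp: sq_tendsto_def intro: sq_integrable_diff)
  have "(\<lambda>n. LINT x|M. (norm ((F n x - G n x) - (f x - g x)))\<^sup>2) \<longlonglongrightarrow> 0"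
  proof (rule tendsto_sandwich[OF _ _ tendsto_const])
    show "\<forall>\<^sub>F n in sequentially. (LINT x|M. (norm ((F n x - G n x) - (f x - g x)))\<^sup>2) \<le>
        2 * (LINT x|M. (norm (F n x - f x))\<^sup>2) + 2 * (LINT x|M. (norm (G n x - g x))\<^sup>2)"
    proof (rule always_eventually, rule allI)
      fix n
      have "(LINT x|M. (norm ((F n x - G n x) - (f x - g x)))\<^sup>2) \<le>
        (LINT x|M. 2 * (norm (F n x - f x))\<^sup>2 + 2 * (norm (G n x - g x))\<^sup>2)"
      proof (rule integral_mono)
        show "integrable M (\<lambda>x. (norm ((F n x - G n x) - (f x - g x)))\<^sup>2)"
          using F G f g by (intro sq_integrableD(2) sq_integrable_diff)
        show "(norm ((F n x - G n x) - (f x - g x)))\<^sup>2 \<le> 2 * (norm (F n x - f x))\<^sup>2 + 2 * (norm (G n x - g x))\<^sup>2" for x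
          using norm_diff_sq_le[of "F n x - f x" "G n x - g x"] by (simp add: algebra_simps)
      qed (use sq_integrableD(2)[OF F(2)] sq_integrableD(2)[OF G(2)] in auto)
      then show "(LINT x|M. (norm ((F n x - G n x) - (f x - g x)))\<^sup>2) \<le>
        2 * (LINT x|M. (norm (F n x - f x))\<^sup>2) + 2 * (LINT x|M. (norm (G n x - g x))\<^sup>2)"
        using sq_integrableD(2)[OF F(2)] sq_integrableD(2)[OF G(2)] by simp
    qed
    have "(\<lambda>n. 2 * (LINT x|M. (norm (F n x - f x))\<^sup>2) + 2 * (LINT x|M. (norm (G n x - g x))\<^sup>2)) \<longlonglongrightarrow> 2 * 0 + 2 * 0"
      using assms by (intro tendsto_intros) (auto simp: sq_tendsto_def)
    then show "(\<lambda>n. 2 * (LINT x|M. (norm (F n x - f x))\<^sup>2) + 2 * (LINT x|M. (norm (G n x - g x))\<^sup>2)) \<longlonglongrightarrow> 0"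
      by simp
  qed auto
  with F G f g show ?thesis
    by (simp add: sq_tendsto_def sq_integrable_diff)
qed

lemma sq_tendsto_subseq:
  assumes "sq_tendsto M F f" "strict_mono r"
  shows "sq_tendsto M (\<lambda>n. F (r n)) f"
  using assms LIMSEQ_subseq_LIMSEQ[OF _ assms(2), of "\<lambda>n. LINT x|M. (norm (F n x - f x))\<^sup>2"]
  by (auto simp: sq_tendsto_def comp_def)

lemma sq_tendsto_AE_subseq:
  assumes "sq_tendsto M F f"
  obtains r where "strict_mono r" "AE x in M. (\<lambda>n. F (r n) x) \<longlonglongrightarrow> f x"
proof -
  have "\<exists>r::nat\<Rightarrow>nat. strict_mono r \<and> (AE x in M. (\<lambda>n. (norm (F (r n) x - f x))\<^sup>2) \<longlonglongrightarrow> 0)"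
  proof (rule tendsto_L1_AE_subseq)
    show "integrable M (\<lambda>x. (norm (F n x - f x))\<^sup>2)" for n
      using assms by (intro sq_integrableD(2) sq_integrable_diff) (auto simp: sq_tendsto_def)
  qed (use assms in \<open>simp add: sq_tendsto_def\<close>)
  then obtain r where r: "strict_mono r" "AE x in M. (\<lambda>n. (norm (F (r n) x - f x))\<^sup>2) \<longlonglongrightarrow> 0"
    by blast
  from r(2) have "AE x in M. (\<lambda>n. F (r n) x) \<longlonglongrightarrow> f x"
  proof eventually_elim
    case (elim x)
    from tendsto_real_sqrt[OF elim] show ?case
      by (simp add: tendsto_norm_zero_iff LIM_zero_iff)
  qed
  with r(1) that show thesis by blast
qed

lemma sq_tendsto_dominated:
  assumes F: "\<And>n. F n \<in> borel_measurable M" and f: "f \<in> borel_measurable M" and g: "sq_integrable M g"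
    and bound: "\<And>n. AE x in M. norm (F n x) \<le> norm (g x)"
    and lim: "AE x in M. (\<lambda>n. F n x) \<longlonglongrightarrow> f x"
  shows "sq_tendsto M F f"
proof -
  note [measurable] = F f sq_integrableD(1)[OF g]
  have F': "sq_integrable M (F n)" for n
    using g F bound by (rule sq_integrable_bound)
  have all: "AE x in M. \<forall>n. norm (F n x) \<le> norm (g x)"
    using bound by (simp add: AE_all_countable)
  have f_bound: "AE x in M. norm (f x) \<le> norm (g x)"
    using all lim
  proof eventually_elim
    case (elim x)
    then show ?case
      using LIMSEQ_le_const2[OF tendsto_norm[OF elim(2)]] by blast
  qed
  with g f have f': "sq_integrable M f"
    by (rule sq_integrable_bound)
  have "(\<lambda>n. LINT x|M. (norm (F n x - f x))\<^sup>2) \<longlonglongrightarrow> (LINT x|M. 0)"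
  proof (rule integral_dominated_convergence)
    show "integrable M (\<lambda>x. 4 * (norm (g x))\<^sup>2)"
      using sq_integrableD(2)[OF g] by simp
    show "AE x in M. (\<lambda>n. (norm (F n x - f x))\<^sup>2) \<longlonglongrightarrow> 0"
      using lim
    proof eventually_elim
      case (elim x)
      have "(\<lambda>n. (norm (F n x - f x))\<^sup>2) \<longlonglongrightarrow> (norm (f x - f x))\<^sup>2"
        by (intro tendsto_intros elim)
      then show ?case by simp
    qed
    show "AE x in M. norm ((norm (F n x - f x))\<^sup>2) \<le> 4 * (norm (g x))\<^sup>2" for n
      using bound[of n] f_bound
    proof eventually_elim
      case (elim x)
      then have "(norm (F n x))\<^sup>2 \<le> (norm (g x))\<^sup>2" "(norm (f x))\<^sup>2 \<le> (norm (g x))\<^sup>2"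
        by (auto intro: power_mono)
      with norm_diff_sq_le[of "F n x" "f x"]
      have "(norm (F n x - f x))\<^sup>2 \<le> 4 * (norm (g x))\<^sup>2" by linarith
      then show ?case by simp
    qed
  qed measurable
  with F' f' show ?thesis
    by (simp add: sq_tendsto_def)
qed

lemma sq_tendsto_diagonal:
  assumes u: "sq_tendsto M U u" and F: "\<And>n. sq_integrable M (F n)"
    and near: "\<And>n. (LINT x|M. (norm (F n x - U n x))\<^sup>2) \<le> 1 / real (Suc n)"
  shows "sq_tendsto M F u"
proof -
  have U: "sq_integrable M (U n)" for n using u by (simp add: sq_tendsto_def)
  have "sq_tendsto M (\<lambda>n x. U n x - F n x) (\<lambda>x. 0)"
    unfolding sq_tendsto_def
  proof (intro conjI allI)
    show "(\<lambda>n. LINT x|M. (norm (U n x - F n x - 0))\<^sup>2) \<longlonglongrightarrow> 0"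
    proof (rule tendsto_sandwich[OF _ _ tendsto_const])
      show "\<forall>\<^sub>F n in sequentially. (LINT x|M. (norm (U n x - F n x - 0))\<^sup>2) \<le> 1 / real (Suc n)"
        using near by (simp add: norm_minus_commute)
      show "(\<lambda>n. 1 / real (Suc n)) \<longlonglongrightarrow> 0"
        by (rule LIMSEQ_Suc[OF lim_1_over_n])
    qed auto
  qed (use U F in \<open>auto simp: sq_integrable_diff\<close>, simp add: sq_integrable_def)
  from sq_tendsto_diff[OF u this] show ?thesis by simp
qed

text \<open>Links the extended nonnegative integrals in the definition of the Sobolev space to
  Bochner integrals. From left to right, square-integrability of \<open>f\<close> must be recovered
  first: some distance is below \<open>1\<close>, so \<open>F n - f\<close> is square-integrable,
  and so is \<open>f = F n - (F n - f)\<close>.\<close>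

lemma sq_tendsto_iff_nn_integral:
  assumes F: "\<And>n. sq_integrable M (F n)" and [measurable]: "f \<in> borel_measurable M"
  shows "(\<lambda>n. \<integral>\<^sup>+x. ennreal ((norm (F n x - f x))\<^sup>2) \<partial>M) \<longlonglongrightarrow> 0 \<longleftrightarrow> sq_tendsto M F f"
proof -
  note [measurable] = sq_integrableD(1)[OF F]
  have nn: "(\<integral>\<^sup>+x. ennreal ((norm (F n x - f x))\<^sup>2) \<partial>M) = ennreal (LINT x|M. (norm (F n x - f x))\<^sup>2)"
    if "sq_integrable M f" for n
    using that F by (intro nn_integral_eq_integral sq_integrableD(2) sq_integrable_diff) auto
  show ?thesis
  proof
    assume lim: "(\<lambda>n. \<integral>\<^sup>+x. ennreal ((norm (F n x - f x))\<^sup>2) \<partial>M) \<longlonglongrightarrow> 0"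
    then have "\<forall>\<^sub>F n in sequentially. (\<integral>\<^sup>+x. ennreal ((norm (F n x - f x))\<^sup>2) \<partial>M) < 1"
      by (rule order_tendstoD) simp
    then obtain n where "(\<integral>\<^sup>+x. ennreal ((norm (F n x - f x))\<^sup>2) \<partial>M) < 1"
      by (auto simp: eventually_sequentially)
    then have "(\<integral>\<^sup>+x. ennreal ((norm (F n x - f x))\<^sup>2) \<partial>M) < \<infinity>"
      by (rule less_trans) simp
    then have "sq_integrable M (\<lambda>x. F n x - f x)"
      unfolding sq_integrable_def by (intro conjI integrableI_bounded) auto
    from sq_integrable_diff[OF F[of n] this] have f: "sq_integrable M f" by simp
    then show "sq_tendsto M F f"
      using lim F unfolding nn[OF f] by (simp add: sq_tendsto_def tendsto_ennreal_iff flip: ennreal_0)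
  next
    assume *: "sq_tendsto M F f"
    then have f: "sq_integrable M f" by (simp add: sq_tendsto_def)
    show "(\<lambda>n. \<integral>\<^sup>+x. ennreal ((norm (F n x - f x))\<^sup>2) \<partial>M) \<longlonglongrightarrow> 0"
      unfolding nn[OF f] using * by (simp add: sq_tendsto_def tendsto_ennreal_iff flip: ennreal_0)
  qed
qed

section \<open>Smooth functions and regularized negative parts\<close>

abbreviation partial :: "'a::euclidean_space \<Rightarrow> ('a \<Rightarrow> real) \<Rightarrow> 'a \<Rightarrow> real" where
  "partial b f x \<equiv> frechet_derivative f (at x) b"

definition smooth :: "('a::euclidean_space \<Rightarrow> real) \<Rightarrow> bool" where
  "smooth f \<longleftrightarrow> (\<forall>k. C_k k f)"

lemma partial_eq: "(f has_derivative D) (at x) \<Longrightarrow> partial b f x = D b"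
  by (metis frechet_derivative_at)

lemma C_k_SucD:
  assumes "C_k (Suc k) f"
  shows "f differentiable (at x)" "b \<in> Basis \<Longrightarrow> C_k k (partial b f)"
  using assms by auto

lemma C_k_SucI:
  assumes "\<And>x. (f has_derivative D x) (at x)" "\<And>b. b \<in> Basis \<Longrightarrow> C_k k (\<lambda>x. D x b)"
  shows "C_k (Suc k) f"
  using assms partial_eq[OF assms(1)] by (auto simp: differentiable_def)

lemma C_k_Suc_imp: "C_k (Suc k) f \<Longrightarrow> C_k k f"
proof (induction k arbitrary: f)
  case 0
  then show ?case
    using differentiable_imp_continuous_within continuous_at_imp_continuous_on by (metis C_k.simps(1) C_k_SucD(1))
next
  case (Suc k)
  then show ?case
    using C_k_SucD[OF Suc.prems] by simp
qed

lemma has_derivative_partial: "C_k (Suc k) f \<Longrightarrow> (f has_derivative (\<lambda>b. partial b f x)) (at x)"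
  using C_k_SucD(1) frechet_derivative_works by fastforce

lemma C_k_const [simp]: "C_k k (\<lambda>x. c)"
proof (induction k arbitrary: c)
  case (Suc k)
  then show ?case
    by (intro C_k_SucI[where D = "\<lambda>x b. 0"]) auto
qed simp

lemma C_k_add: "C_k k f \<Longrightarrow> C_k k g \<Longrightarrow> C_k k (\<lambda>x. f x + g x)"
proof (induction k arbitrary: f g)
  case 0
  then show ?case by (simp add: continuous_on_add)
next
  case (Suc k)
  show ?case
    by (rule C_k_SucI[OF has_derivative_add[OF Suc.prems[THEN has_derivative_partial]]])
       (intro Suc.IH C_k_SucD(2)[OF Suc.prems(1)] C_k_SucD(2)[OF Suc.prems(2)])
qed

lemma C_k_mult: "C_k k f \<Longrightarrow> C_k k g \<Longrightarrow> C_k k (\<lambda>x. f x * g x)"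
proof (induction k arbitrary: f g)
  case 0
  then show ?case by (simp add: continuous_on_mult)
next
  case (Suc k)
  show ?case
    by (rule C_k_SucI[OF has_derivative_mult[OF Suc.prems[THEN has_derivative_partial]]])
       (intro C_k_add Suc.IH C_k_SucD(2)[OF Suc.prems(1)] C_k_SucD(2)[OF Suc.prems(2)] Suc.prems[THEN C_k_Suc_imp])
qed

lemma C_k_diff: "C_k k f \<Longrightarrow> C_k k g \<Longrightarrow> C_k k (\<lambda>x. f x - g x)"
  using C_k_add[OF _ C_k_mult[OF C_k_const[of k "-1"]], of f g] by simp

lemma sqrt_sq_add_has_derivative:
  assumes "0 < c"
  shows "((\<lambda>s. sqrt (s\<^sup>2 + c)) has_real_derivative t * inverse (sqrt (t\<^sup>2 + c))) (at t)"
proof -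
  have "0 < t\<^sup>2 + c"
    using assms by (simp add: add_nonneg_pos)
  then have "((\<lambda>s. sqrt (s\<^sup>2 + c)) has_real_derivative inverse (sqrt (t\<^sup>2 + c)) / 2 * (2 * t)) (at t)"
    by (intro DERIV_chain2[of sqrt] DERIV_real_sqrt) (auto intro!: derivative_eq_intros)
  then show ?thesis by (simp add: mult.commute)
qed

text \<open>\<open>w = (f\<^sup>2 + c)\<^bsup>-1/2\<^esup>\<close> satisfies \<open>dw = - w\<^sup>3 f df\<close>, so each further order of regularity of \<open>w\<close>
  follows from the previous one.\<close>

lemma C_k_inverse_sqrt:
  assumes "0 < c" "C_k k f"
  shows "C_k k (\<lambda>x. inverse (sqrt ((f x)\<^sup>2 + c)))"
  using assms(2)
proof (induction k)
  case 0
  have "(f x)\<^sup>2 + c \<noteq> 0" for x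
    using assms(1) by (smt (verit) zero_le_power2)
  with 0 show ?case
    by (auto intro!: continuous_intros simp: continuous_on_eq_continuous_at[symmetric])
next
  case (Suc k)
  define w where "w x = inverse (sqrt ((f x)\<^sup>2 + c))" for x
  have "(w has_derivative (\<lambda>b. - (w x * w x * w x * f x * partial b f x))) (at x)" for x
  proof -
    define t where "t = (f x)\<^sup>2 + c"
    have t: "0 < t"
      using assms(1) by (simp add: t_def add_nonneg_pos)
    from DERIV_inverse'[OF sqrt_sq_add_has_derivative[OF assms(1)], of "f x"]
    have "((\<lambda>s. inverse (sqrt (s\<^sup>2 + c))) has_real_derivative - (w x * w x * w x * f x)) (at (f x))"
      using t unfolding w_def t_def by (simp add: mult_ac)
    from has_derivative_compose[OF has_derivative_partial[OF Suc.prems] this[unfolded has_field_derivative_def]]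
    show ?thesis
      by (simp add: w_def[abs_def] mult_ac)
  qed
  moreover have "C_k k (\<lambda>x. - (w x * w x * w x * f x * partial b f x))" if "b \<in> Basis" for b
  proof -
    have "C_k k w"
      unfolding w_def using Suc.IH[OF C_k_Suc_imp[OF Suc.prems]] .
    then have "C_k k (\<lambda>x. (-1) * (w x * w x * w x * f x * partial b f x))"
      by (intro C_k_mult C_k_const C_k_Suc_imp[OF Suc.prems] C_k_SucD(2)[OF Suc.prems that])
    then show ?thesis by simp
  qed
  ultimately show ?case
    unfolding w_def[symmetric] by (rule C_k_SucI)
qed

lemma smooth_partial: "smooth f \<Longrightarrow> b \<in> Basis \<Longrightarrow> smooth (partial b f)"
  unfolding smooth_def by (metis C_k_SucD(2))

lemma smooth_has_derivative: "smooth f \<Longrightarrow> (f has_derivative (\<lambda>b. partial b f x)) (at x)"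
  unfolding smooth_def by (metis has_derivative_partial)

lemma smooth_continuous: "smooth f \<Longrightarrow> continuous_on UNIV f"
  unfolding smooth_def by (metis C_k.simps(1))

lemma smooth_diff: "smooth f \<Longrightarrow> smooth g \<Longrightarrow> smooth (\<lambda>x. f x - g x)"
  by (simp add: smooth_def C_k_diff)

text \<open>A smooth approximation of \<open>max (- t) 0\<close> for small \<open>e\<close>.
  Subtracting \<open>e\<close> makes the value at \<open>0\<close> vanish, so composition with it
  preserves compact support.\<close>

definition neg_part_approx :: "real \<Rightarrow> real \<Rightarrow> real" where
  "neg_part_approx e t = (sqrt (t\<^sup>2 + e\<^sup>2) - e - t) / 2"

definition neg_part_approx' :: "real \<Rightarrow> real \<Rightarrow> real" where
  "neg_part_approx' e t = (t * inverse (sqrt (t\<^sup>2 + e\<^sup>2)) - 1) / 2"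

lemma neg_part_approx_has_derivative:
  assumes "0 < e"
  shows "(neg_part_approx e has_real_derivative neg_part_approx' e t) (at t)"
  unfolding neg_part_approx_def[abs_def] neg_part_approx'_def
  using assms by (auto intro!: derivative_eq_intros sqrt_sq_add_has_derivative simp: not_sum_power2_lt_zero)

lemma smooth_neg_part_approx:
  assumes "0 < e" "smooth f"
  shows "smooth (\<lambda>x. neg_part_approx e (f x))"
proof -
  have sq: "0 < t\<^sup>2 + e\<^sup>2" for t
    using assms(1) by (simp add: add_nonneg_pos)
  \<comment> \<open>Writing the root as \<open>q = (q * q) * inverse q\<close> expresses the
    approximation through sums and products of \<open>f\<close> and the inverse root, whose
    regularity is already known.\<close>
  have "neg_part_approx e t = 1/2 * ((t * t + e * e) * inverse (sqrt (t\<^sup>2 + e\<^sup>2)) - e - t)" for t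
  proof -
    define q where "q = sqrt (t\<^sup>2 + e\<^sup>2)"
    have "0 < q" "t * t + e * e = q * q"
      using sq[of t] by (auto simp: q_def power2_eq_square)
    then show ?thesis
      by (simp add: neg_part_approx_def q_def[symmetric])
  qed
  then have eq: "(\<lambda>x. neg_part_approx e (f x)) =
      (\<lambda>x. 1/2 * ((f x * f x + e * e) * inverse (sqrt ((f x)\<^sup>2 + e\<^sup>2)) - e - f x))"
    by metis
  show ?thesis
    unfolding eq smooth_def using assms
    by (intro allI C_k_mult C_k_diff C_k_add C_k_const C_k_inverse_sqrt) (auto simp: smooth_def)
qed

lemma neg_part_approx'_bounds:
  assumes "0 < e"
  shows "-1 \<le> neg_part_approx' e t" "neg_part_approx' e t \<le> 0"
proof -
  have "0 < t\<^sup>2 + e\<^sup>2"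
    using assms by (simp add: add_nonneg_pos)
  moreover have "\<bar>t\<bar> \<le> sqrt (t\<^sup>2 + e\<^sup>2)"
    by (rule real_le_rsqrt) simp
  ultimately have "\<bar>t * inverse (sqrt (t\<^sup>2 + e\<^sup>2))\<bar> \<le> 1"
    by (simp add: abs_mult field_simps)
  then show "-1 \<le> neg_part_approx' e t" "neg_part_approx' e t \<le> 0"
    by (auto simp: neg_part_approx'_def abs_le_iff)
qed

lemma neg_part_approx_lipschitz:
  assumes "0 < e"
  shows "\<bar>neg_part_approx e a - neg_part_approx e b\<bar> \<le> \<bar>a - b\<bar>"
proof -
  have "norm (neg_part_approx e a - neg_part_approx e b) \<le> 1 * norm (a - b)"
    using neg_part_approx_has_derivative[OF assms] neg_part_approx'_bounds[OF assms]
    by (intro field_differentiable_bound[where S = UNIV and f' = "neg_part_approx' e"])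
       (auto simp: abs_le_iff intro: order_trans)
  then show ?thesis by simp
qed

lemma neg_part_approx_0 [simp]: "0 \<le> e \<Longrightarrow> neg_part_approx e 0 = 0"
  by (simp add: neg_part_approx_def)

lemma neg_part_approx_tendsto:
  assumes "e \<longlonglongrightarrow> 0"
  shows "(\<lambda>n. neg_part_approx (e n) t) \<longlonglongrightarrow> max (- t) 0"
proof -
  have "(\<lambda>n. neg_part_approx (e n) t) \<longlonglongrightarrow> (sqrt (t\<^sup>2 + 0\<^sup>2) - 0 - t) / 2"
    unfolding neg_part_approx_def by (intro tendsto_intros assms) auto
  then show ?thesis
    by (simp add: max_def abs_if split: if_splits)
qed

lemma neg_part_approx'_tendsto:
  assumes "e \<longlonglongrightarrow> 0"
  shows "(\<lambda>n. neg_part_approx' (e n) t) \<longlonglongrightarrow> (sgn t - 1) / 2"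
proof (cases "t = 0")
  case False
  then have "(\<lambda>n. neg_part_approx' (e n) t) \<longlonglongrightarrow> (t * inverse (sqrt (t\<^sup>2 + 0\<^sup>2)) - 1) / 2"
    unfolding neg_part_approx'_def by (intro tendsto_intros assms) auto
  then show ?thesis
    using False by (simp add: sgn_if abs_if field_simps split: if_splits)
qed (simp add: neg_part_approx'_def)

lemma isCont_neg_part_approx':
  assumes "0 < e"
  shows "isCont (neg_part_approx' e) t"
proof -
  have "0 < t\<^sup>2 + e\<^sup>2"
    using assms by (simp add: add_nonneg_pos)
  then show ?thesis
    unfolding neg_part_approx'_def[abs_def] by (intro continuous_intros) auto
qed

section \<open>Stability of the class of test functions\<close>

lemma test_functionsD:
  assumes "f \<in> test_functions"
  shows "smooth f" "compact (closure {x. f x \<noteq> 0})" "closure {x. f x \<noteq> 0} \<subseteq> ball 0 1"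
  using assms by (auto simp: test_functions_def smooth_def)

lemma test_functionsI:
  assumes "smooth g" "compact K" "K \<subseteq> ball 0 1" "\<And>x. x \<notin> K \<Longrightarrow> g x = 0"
  shows "g \<in> test_functions"
proof -
  have sub: "closure {x. g x \<noteq> 0} \<subseteq> K"
    using assms by (intro closure_minimal compact_imp_closed) auto
  then have "compact (closure {x. g x \<noteq> 0})"
    using compact_Int_closed[OF assms(2) closed_closure, of "{x. g x \<noteq> 0}"] by (simp add: Int_absorb1)
  with sub assms show ?thesis
    by (auto simp: test_functions_def smooth_def)
qed

lemma test_functions_support:
  assumes "f \<in> test_functions"
  shows "\<exists>K. compact K \<and> K \<subseteq> ball 0 1 \<and> (\<forall>x. x \<notin> K \<longrightarrow> f x = 0)"
  using test_functionsD(2,3)[OF assms] closure_subset[of "{x. f x \<noteq> 0}"]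
  by (intro exI[of _ "closure {x. f x \<noteq> 0}"]) auto

lemma test_functions_diff:
  assumes "f \<in> test_functions" "g \<in> test_functions"
  shows "(\<lambda>x. f x - g x) \<in> test_functions"
proof -
  obtain K where K: "compact K" "K \<subseteq> ball 0 1" "\<And>x. x \<notin> K \<Longrightarrow> f x = 0"
    using test_functions_support[OF assms(1)] by blast
  obtain L where L: "compact L" "L \<subseteq> ball 0 1" "\<And>x. x \<notin> L \<Longrightarrow> g x = 0"
    using test_functions_support[OF assms(2)] by blast
  show ?thesis
  proof (rule test_functionsI)
    show "smooth (\<lambda>x. f x - g x)"
      using assms by (intro smooth_diff test_functionsD(1))
    show "compact (K \<union> L)" "K \<union> L \<subseteq> ball 0 1"
      using K(1,2) L(1,2) by auto
  qed (simp add: K(3) L(3))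
qed

lemma test_functions_neg_part_approx:
  assumes "f \<in> test_functions" "0 < e"
  shows "(\<lambda>x. neg_part_approx e (f x)) \<in> test_functions"
proof -
  obtain K where K: "compact K" "K \<subseteq> ball 0 1" "\<And>x. x \<notin> K \<Longrightarrow> f x = 0"
    using test_functions_support[OF assms(1)] by blast
  show ?thesis
  proof (rule test_functionsI[OF _ K(1,2)])
    show "smooth (\<lambda>x. neg_part_approx e (f x))"
      using assms by (intro smooth_neg_part_approx test_functionsD(1))
  qed (use assms(2) in \<open>simp add: K(3)\<close>)
qed

lemma partial_outside_support:
  assumes "closed K" "\<And>x. x \<notin> K \<Longrightarrow> f x = 0" "x \<notin> K"
  shows "partial b f x = 0"
proof -
  have "(f has_derivative (\<lambda>_. 0)) (at x)"
    using assms by (intro has_derivative_transform_within_open[OF has_derivative_const, of "- K" x 0 f]) auto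
  then show ?thesis by (rule partial_eq)
qed

section \<open>Integration by parts in the ball\<close>

lemma integral_lborel_translate:
  fixes F :: "'a::euclidean_space \<Rightarrow> real"
  assumes [measurable]: "F \<in> borel_measurable borel"
  shows "(LINT x|lborel. F (c + x)) = (LINT x|lborel. F x)"
proof -
  have "(LINT x|lborel. F (c + x)) = (LINT x|distr lborel borel ((+) c). F x)"
    by (subst integral_distr) auto
  then show ?thesis by (simp add: lborel_distr_plus)
qed

lemma integrable_lborel_compact_support:
  fixes g :: "'a::euclidean_space \<Rightarrow> real"
  assumes "continuous_on UNIV g" "compact K" "\<And>x. x \<notin> K \<Longrightarrow> g x = 0"
  shows "integrable lborel g"
proof -
  have "integrable lborel (\<lambda>x. indicator K x *\<^sub>R g x)"
    using assms by (intro borel_integrable_compact) (auto intro: continuous_on_subset)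
  moreover have "(\<lambda>x. indicator K x *\<^sub>R g x) = g"
    using assms(3) by (auto simp: indicator_def fun_eq_iff)
  ultimately show ?thesis by simp
qed

text \<open>The integral of \<open>F (x + t b)\<close> does not depend on \<open>t\<close>, so its derivative at \<open>t = 0\<close> vanishes.\<close>

lemma integral_directional_derivative_eq_0:
  fixes F :: "'a::euclidean_space \<Rightarrow> real"
  assumes D: "\<And>x. (F has_derivative D x) (at x)" and cont: "continuous_on UNIV (\<lambda>x. D x b)"
    and K: "compact K" "\<And>x. x \<notin> K \<Longrightarrow> F x = 0" "\<And>x. x \<notin> K \<Longrightarrow> D x b = 0"
  shows "(LINT x|lborel. D x b) = 0"
proof -
  define t where "t n = 1 / real (Suc n)" for n
  have t: "0 < t n" "t n \<le> 1" for n
    by (auto simp: t_def divide_le_eq)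
  have "t \<longlonglongrightarrow> 0"
    unfolding t_def[abs_def] by (rule LIMSEQ_Suc[OF lim_1_over_n])
  then have t_at: "filterlim t (at 0) sequentially"
    using t(1) by (intro filterlim_atI) (auto intro!: always_eventually simp: less_le)
  have F_cont: "continuous_on UNIV F"
    using D by (intro continuous_at_imp_continuous_on) (auto intro: has_derivative_continuous)
  then have F_meas [measurable]: "F \<in> borel_measurable borel"
    by (rule borel_measurable_continuous_onI)
  have F_int: "integrable lborel F"
    using F_cont K(1,2) by (rule integrable_lborel_compact_support)
  have line: "((\<lambda>s. F (x + s *\<^sub>R b)) has_real_derivative D (x + s *\<^sub>R b) b) (at s)" for x s
  proof -
    have "((\<lambda>s. x + s *\<^sub>R b) has_derivative (\<lambda>h. h *\<^sub>R b)) (at s)"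
      by (auto intro!: derivative_eq_intros)
    from has_derivative_compose[OF this D]
    show ?thesis
      unfolding has_field_derivative_def
      using linear_scale[OF has_derivative_linear[OF D]] by (simp add: mult_commute_abs)
  qed
  have "bounded ((\<lambda>x. D x b) ` K)"
    using K(1) cont by (intro compact_imp_bounded compact_continuous_image) (auto intro: continuous_on_subset)
  then obtain B where "0 < B" and B': "\<And>x. x \<in> K \<Longrightarrow> \<bar>D x b\<bar> \<le> B"
    by (auto simp: bounded_pos)
  have B: "\<bar>D x b\<bar> \<le> B" for x
    using B'[of x] K(3)[of x] \<open>0 < B\<close> by (cases "x \<in> K") auto
  obtain R where R: "\<And>x. x \<in> K \<Longrightarrow> norm x \<le> R"
    using compact_imp_bounded[OF K(1)] by (auto simp: bounded_iff)
  define \<Delta> where "\<Delta> n x = (F (t n *\<^sub>R b + x) - F x) / t n" for n x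
  have "(\<lambda>n. LINT x|lborel. \<Delta> n x) \<longlonglongrightarrow> (LINT x|lborel. D x b)"
  proof (rule integral_dominated_convergence)
    \<comment> \<open>The difference quotients are bounded by \<open>B\<close> through the mean
      value inequality. Since \<open>t n \<le> 1\<close>, the shift moves the support by at most
      \<open>norm b\<close>, so outside this enlarged ball both values of \<open>F\<close>
      vanish.\<close>
    show "integrable lborel (\<lambda>x. B * indicator (cball 0 (R + norm b)) x :: real)"
      using emeasure_compact_finite[OF compact_cball]
      by (intro integrable_mult_right integrable_real_indicator) (auto simp: top.not_eq_extremum)
    show "AE x in lborel. (\<lambda>n. \<Delta> n x) \<longlonglongrightarrow> D x b"
    proof (rule AE_I2)
      fix x
      have "(\<lambda>h. (F (x + (0 + h) *\<^sub>R b) - F (x + 0 *\<^sub>R b)) / h) \<midarrow>0\<rightarrow> D (x + 0 *\<^sub>R b) b"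
        using line[of x 0] unfolding DERIV_def .
      from filterlim_compose[OF this t_at] show "(\<lambda>n. \<Delta> n x) \<longlonglongrightarrow> D x b"
        by (simp add: \<Delta>_def add.commute)
    qed
    show "AE x in lborel. norm (\<Delta> n x) \<le> B * indicator (cball 0 (R + norm b)) x" for n
    proof (rule AE_I2)
      fix x
      show "norm (\<Delta> n x) \<le> B * indicator (cball 0 (R + norm b)) x"
      proof (cases "x \<in> cball 0 (R + norm b)")
        case True
        have "norm (F (x + t n *\<^sub>R b) - F (x + 0 *\<^sub>R b)) \<le> B * norm (t n - 0)"
          using line B by (intro field_differentiable_bound[where S = UNIV and f = "\<lambda>s. F (x + s *\<^sub>R b)"]) auto
        with True t(1)[of n] show ?thesis
          by (simp add: \<Delta>_def divide_le_eq add.commute)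
      next
        case False
        have "norm (t n *\<^sub>R b) \<le> norm b"
          using t[of n] by (simp add: mult_left_le_one_le)
        then have "norm x \<le> norm (t n *\<^sub>R b + x) + norm b"
          using norm_triangle_ineq4[of "t n *\<^sub>R b + x" "t n *\<^sub>R b"] by simp
        with False have "R < norm (t n *\<^sub>R b + x)" by simp
        moreover have "R < norm x"
          using False norm_ge_zero[of b] unfolding mem_cball dist_0_norm by linarith
        ultimately have "F (t n *\<^sub>R b + x) = 0" "F x = 0"
          using R K(2) by (metis not_le)+
        with False show ?thesis
          by (simp add: \<Delta>_def)
      qed
    qed
    show "(\<lambda>x. D x b) \<in> borel_measurable lborel"
      using borel_measurable_continuous_onI[OF cont] by simp
    show "\<Delta> n \<in> borel_measurable lborel" for n
      unfolding \<Delta>_def by measurable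
  qed
  moreover have "(LINT x|lborel. \<Delta> n x) = 0" for n
  proof -
    have "integrable (distr lborel borel ((+) (t n *\<^sub>R b))) F"
      using F_int by (simp add: lborel_distr_plus)
    then have "integrable lborel (\<lambda>x. F (t n *\<^sub>R b + x))"
      by (subst (asm) integrable_distr_eq) auto
    then show ?thesis
      unfolding \<Delta>_def using F_int integral_lborel_translate[OF F_meas] by simp
  qed
  ultimately show ?thesis
    by (simp add: LIMSEQ_const_iff)
qed

text \<open>Continuity is asked on the ball only, because the conformal factor blows up at the
  sphere. Compact support inside the ball makes products with such coefficients continuous on the
  whole space.\<close>

definition compact_cts :: "('a::euclidean_space \<Rightarrow> real) \<Rightarrow> bool" where
  "compact_cts h \<longleftrightarrow> continuous_on (ball 0 1) h \<and>
     (\<exists>K. compact K \<and> K \<subseteq> ball 0 1 \<and> (\<forall>x. x \<notin> K \<longrightarrow> h x = 0))"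

lemma compact_cts_mult:
  assumes "compact_cts f" "continuous_on (ball 0 1) g"
  shows "compact_cts (\<lambda>x. f x * g x)" "compact_cts (\<lambda>x. g x * f x)"
  using assms by (auto simp: compact_cts_def intro!: continuous_on_mult)

lemma compact_cts_add:
  assumes "compact_cts f" "compact_cts g"
  shows "compact_cts (\<lambda>x. f x + g x)"
proof -
  obtain K where K: "compact K" "K \<subseteq> ball 0 1" "\<And>x. x \<notin> K \<Longrightarrow> f x = 0"
    using assms(1) unfolding compact_cts_def by blast
  obtain L where L: "compact L" "L \<subseteq> ball 0 1" "\<And>x. x \<notin> L \<Longrightarrow> g x = 0"
    using assms(2) unfolding compact_cts_def by blast
  have "continuous_on (ball 0 1) (\<lambda>x. f x + g x)"
    using assms by (auto simp: compact_cts_def intro: continuous_on_add)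
  moreover have "compact (K \<union> L)" "K \<union> L \<subseteq> ball 0 1" "\<forall>x. x \<notin> K \<union> L \<longrightarrow> f x + g x = 0"
    using K L by auto
  ultimately show ?thesis
    unfolding compact_cts_def by blast
qed

lemma compact_cts_0: "compact_cts (\<lambda>x. 0)"
  unfolding compact_cts_def by (auto intro: exI[of _ "{}"])

lemma compact_cts_sum:
  assumes "\<And>i. i \<in> I \<Longrightarrow> compact_cts (f i)"
  shows "compact_cts (\<lambda>x. \<Sum>i\<in>I. f i x)"
  using assms by (induction I rule: infinite_finite_induct) (auto intro: compact_cts_add compact_cts_0)

lemma compact_cts_continuous_UNIV:
  assumes "compact_cts h"
  shows "continuous_on UNIV h"
proof -
  obtain K where K: "compact K" "K \<subseteq> ball 0 1" "\<forall>x. x \<notin> K \<longrightarrow> h x = 0"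
    using assms unfolding compact_cts_def by blast
  have "continuous_on (ball 0 1 \<union> - K) h"
  proof (rule continuous_on_open_Un)
    show "continuous_on (- K) h"
      using K(3) by (subst continuous_on_cong[OF refl, of _ _ "\<lambda>_. 0"]) auto
  qed (use assms K(1) in \<open>auto simp: compact_cts_def compact_imp_closed open_Compl\<close>)
  moreover have "ball 0 1 \<union> - K = UNIV"
    using K(2) by auto
  ultimately show ?thesis by simp
qed

lemma compact_cts_integrable_lborel:
  assumes "compact_cts h"
  shows "integrable lborel h"
  using compact_cts_continuous_UNIV[OF assms] integrable_lborel_compact_support assms
  unfolding compact_cts_def by blast

lemma compact_cts_integral_directional_derivative:
  assumes F: "compact_cts F" and D: "\<And>x. x \<in> ball 0 1 \<Longrightarrow> (F has_derivative D x) (at x)"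
    and Db: "compact_cts (\<lambda>x. D x b)"
  shows "(LINT x|lborel. D x b) = 0"
proof -
  obtain K where K: "compact K" "K \<subseteq> ball 0 1" "\<forall>x. x \<notin> K \<longrightarrow> F x = 0"
    using F unfolding compact_cts_def by blast
  obtain L where L: "compact L" "L \<subseteq> ball 0 1" "\<forall>x. x \<notin> L \<longrightarrow> D x b = 0"
    using Db unfolding compact_cts_def by blast
  \<comment> \<open>The derivative \<open>D\<close> is known only inside the ball. At other points
    \<open>F\<close> vanishes on the open complement of \<open>K\<close>, so its derivative there is
    \<open>0\<close>.\<close>
  define D' where "D' x = (if x \<in> ball 0 1 then D x else (\<lambda>_. 0))" for x
  have D'b: "(\<lambda>x. D' x b) = (\<lambda>x. D x b)"
    using L by (auto simp: D'_def fun_eq_iff)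
  have "(LINT x|lborel. D' x b) = 0"
  proof (rule integral_directional_derivative_eq_0)
    show "(F has_derivative D' x) (at x)" for x
    proof (cases "x \<in> ball 0 1")
      case False
      have "(F has_derivative (\<lambda>_. 0)) (at x)"
        using K False
        by (intro has_derivative_transform_within_open[OF has_derivative_const, of "- K" x 0 F])
           (auto simp: compact_imp_closed open_Compl)
      with False show ?thesis by (simp add: D'_def)
    qed (simp add: D D'_def)
    show "continuous_on UNIV (\<lambda>x. D' x b)"
      unfolding D'b by (rule compact_cts_continuous_UNIV[OF Db])
    show "compact (K \<union> L)" using K L by auto
    show "F x = 0" if "x \<notin> K \<union> L" for x
      using that K(3) by auto
    show "D' x b = 0" if "x \<notin> K \<union> L" for x
      using that L(3) by (auto simp: D'_def)
  qed
  then show ?thesis by (simp add: D'b)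
qed

section \<open>The conformal factor and the hyperbolic volume\<close>

lemma conf_factor_pos: "x \<in> ball 0 1 \<Longrightarrow> 0 < conf_factor x"
  by (simp add: conf_factor_def power_less_one_iff abs_square_less_1)

lemma continuous_on_conf_factor [continuous_intros]: "continuous_on (ball 0 1) conf_factor"
proof -
  have "1 - (norm x)\<^sup>2 \<noteq> 0" if "x \<in> ball 0 1" for x :: 'a
    using that abs_square_less_1[of "norm x"] by simp
  then show ?thesis
    unfolding conf_factor_def by (intro continuous_intros) auto
qed

lemma space_hyp_vol: "space hyp_vol = ball 0 1"
  by (simp add: hyp_vol_def)

lemma continuous_on_borel_measurable_hyp_vol:
  fixes h :: "'a::euclidean_space \<Rightarrow> 'b::euclidean_space"
  assumes "continuous_on (ball 0 1) h"
  shows "h \<in> borel_measurable hyp_vol"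
proof -
  have "h \<in> borel_measurable (lebesgue_on (ball 0 1))"
    using assms by (intro continuous_imp_measurable_on_sets_lebesgue) auto
  then show ?thesis
    by (simp add: hyp_vol_def)
qed

text \<open>Hyperbolic integrals become Lebesgue integrals over the whole space, where integration
  by parts is available. The restriction to the ball disappears because \<open>h\<close> vanishes
  outside it.\<close>

lemma compact_cts_hyp_vol:
  fixes h :: "'a::euclidean_space \<Rightarrow> real"
  assumes "compact_cts h"
  shows "integrable hyp_vol h" "(LINT x|hyp_vol. h x) = (LINT x|lborel. conf_factor x ^ DIM('a) * h x)"
proof -
  let ?B = "ball 0 1 :: 'a set" and ?p = "\<lambda>x::'a. conf_factor x ^ DIM('a)"
  have meas: "h \<in> borel_measurable (lebesgue_on ?B)" "?p \<in> borel_measurable (lebesgue_on ?B)"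
    using assms by (auto simp: compact_cts_def intro!: continuous_imp_measurable_on_sets_lebesgue continuous_intros)
  have nonneg: "AE x in lebesgue_on ?B. 0 \<le> ?p x"
    by (rule AE_I2) (auto intro!: zero_le_power less_imp_le[OF conf_factor_pos])
  have cc: "compact_cts (\<lambda>x. ?p x * h x)"
    using assms by (intro compact_cts_mult continuous_intros)
  have ind: "(\<lambda>x. indicator ?B x * (?p x * h x)) = (\<lambda>x. ?p x * h x)"
    using assms by (auto simp: compact_cts_def indicator_def fun_eq_iff)
  have int: "integrable lebesgue (\<lambda>x. ?p x * h x)"
    using compact_cts_integrable_lborel[OF cc] by (subst integrable_completion) auto
  then have "integrable (lebesgue_on ?B) (\<lambda>x. ?p x * h x)"
    by (subst integrable_restrict_space) (auto simp: ind)
  then show "integrable hyp_vol h"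
    unfolding hyp_vol_def using meas nonneg by (subst integrable_density) auto
  have "(LINT x|hyp_vol. h x) = (LINT x|lebesgue_on ?B. ?p x * h x)"
    unfolding hyp_vol_def using meas nonneg by (subst integral_density) auto
  also have "\<dots> = (LINT x|lebesgue. ?p x * h x)"
    by (subst integral_restrict_space) (auto simp: ind)
  also have "\<dots> = (LINT x|lborel. ?p x * h x)"
    using compact_cts_integrable_lborel[OF cc] by (intro integral_completion) auto
  finally show "(LINT x|hyp_vol. h x) = (LINT x|lborel. ?p x * h x)" .
qed

section \<open>The spectral gap for test functions\<close>

definition euclid_grad :: "('a::euclidean_space \<Rightarrow> real) \<Rightarrow> 'a \<Rightarrow> 'a" where
  "euclid_grad f x = (\<Sum>b\<in>Basis. partial b f x *\<^sub>R b)"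

text \<open>The coordinates of the vector field \<open>G\<close> in the orthonormal frame of the
  hyperbolic metric. In them \<open>hyp_inner\<close> is the Euclidean inner product, and
  convergence of gradients is plain \<open>L\<^sup>2\<close> convergence.\<close>

definition unit_grad :: "('a::euclidean_space \<Rightarrow> 'a) \<Rightarrow> 'a \<Rightarrow> 'a" where
  "unit_grad G x = conf_factor x *\<^sub>R G x"

lemma hyp_inner_unit_grad: "hyp_inner x (G x) (H x) = unit_grad G x \<bullet> unit_grad H x"
  by (simp add: hyp_inner_def unit_grad_def power2_eq_square)

lemma inner_euclid_grad: "euclid_grad f x \<bullet> v = (\<Sum>b\<in>Basis. partial b f x * (v \<bullet> b))"
  by (simp add: euclid_grad_def inner_sum_left inner_commute[of v])

lemma unit_grad_classical:
  assumes "x \<in> ball 0 1"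
  shows "unit_grad (hyp_grad_classical f) x = euclid_grad f x /\<^sub>R conf_factor x"
  using conf_factor_pos[OF assms]
  by (simp add: unit_grad_def hyp_grad_classical_def euclid_grad_def power2_eq_square)

lemma conf_factor_has_derivative:
  assumes "x \<in> ball 0 1"
  shows "((\<lambda>x. conf_factor x ^ m) has_derivative (\<lambda>h. real m * conf_factor x ^ (m + 1) * (x \<bullet> h))) (at x)"
proof -
  have ne: "1 - x \<bullet> x \<noteq> 0"
    using assms by (simp add: dot_square_norm power2_eq_1_iff) (metis norm_not_less_zero less_irrefl neg_less_0_iff_less zero_less_one)
  have "((\<lambda>x. 2 / (1 - x \<bullet> x)) has_derivative (\<lambda>h. 4 * (x \<bullet> h) / (1 - x \<bullet> x)\<^sup>2)) (at x)"
    using ne by (auto intro!: derivative_eq_intros simp: power2_eq_square field_simps inner_commute)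
  then have d: "(conf_factor has_derivative (\<lambda>h. (conf_factor x)\<^sup>2 * (x \<bullet> h))) (at x)"
    by (simp add: conf_factor_def[abs_def] dot_square_norm power_divide)
  show ?thesis
  proof (cases m)
    case (Suc k)
    from has_derivative_power[OF d, of m] Suc show ?thesis
      by (simp add: power2_eq_square mult_ac)
  qed auto
qed

lemma test_function_compact_cts:
  assumes "f \<in> test_functions"
  shows "compact_cts f"
  using test_functions_support[OF assms] smooth_continuous[OF test_functionsD(1)[OF assms]]
  by (auto simp: compact_cts_def intro: continuous_on_subset)

lemma test_function_partial:
  assumes "f \<in> test_functions" "b \<in> Basis"
  shows "partial b f \<in> test_functions"
proof -
  obtain K where K: "compact K" "K \<subseteq> ball 0 1" "\<And>x. x \<notin> K \<Longrightarrow> f x = 0"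
    using test_functions_support[OF assms(1)] by blast
  show ?thesis
    by (rule test_functionsI[OF smooth_partial[OF test_functionsD(1)[OF assms(1)] assms(2)] K(1,2)])
       (rule partial_outside_support[OF compact_imp_closed[OF K(1)] K(3)])
qed

lemma test_function_has_derivative:
  "f \<in> test_functions \<Longrightarrow> (f has_derivative (\<lambda>b. partial b f x)) (at x)"
  by (intro smooth_has_derivative test_functionsD(1))

lemma test_function_sq_integrable:
  assumes "f \<in> test_functions"
  shows "sq_integrable hyp_vol f"
proof -
  have cont: "continuous_on (ball 0 1) f"
    using test_function_compact_cts[OF assms] by (simp add: compact_cts_def)
  then have "compact_cts (\<lambda>x. f x * f x)"
    using test_function_compact_cts[OF assms] by (intro compact_cts_mult)
  with cont show ?thesis
    by (auto simp: sq_integrable_def power2_eq_square dest: compact_cts_hyp_vol(1) intro!: continuous_on_borel_measurable_hyp_vol)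
qed

lemma continuous_on_euclid_grad:
  assumes "f \<in> test_functions"
  shows "continuous_on (ball 0 1) (euclid_grad f)"
  unfolding euclid_grad_def[abs_def]
  using test_function_compact_cts[OF test_function_partial[OF assms]]
  by (intro continuous_intros) (auto simp: compact_cts_def)

lemma compact_cts_inner_euclid_grad:
  assumes "f \<in> test_functions" "continuous_on (ball 0 1) v"
  shows "compact_cts (\<lambda>x. euclid_grad f x \<bullet> v x)"
  unfolding inner_euclid_grad
  by (intro compact_cts_sum compact_cts_mult test_function_compact_cts test_function_partial assms continuous_intros) auto

lemma compact_cts_unit_grad_inner:
  assumes "f \<in> test_functions" "g \<in> test_functions"
  shows "compact_cts (\<lambda>x. (euclid_grad f x \<bullet> euclid_grad g x) / (conf_factor x)\<^sup>2)"
  unfolding divide_inverse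
  using conf_factor_pos
  by (intro compact_cts_mult compact_cts_inner_euclid_grad assms continuous_intros continuous_on_euclid_grad) force

lemma AE_hyp_volI: "(\<And>x. x \<in> ball 0 1 \<Longrightarrow> P x) \<Longrightarrow> AE x in hyp_vol. P x"
  by (intro AE_I2) (simp add: space_hyp_vol)

lemma hyp_vol_integral_cong:
  "(\<And>x. x \<in> ball 0 1 \<Longrightarrow> f x = g x) \<Longrightarrow> (LINT x|hyp_vol. f x) = (LINT x|hyp_vol. g x)"
  by (intro Bochner_Integration.integral_cong) (auto simp: space_hyp_vol)

lemma unit_grad_inner_classical:
  assumes "x \<in> ball 0 1"
  shows "unit_grad (hyp_grad_classical f) x \<bullet> unit_grad (hyp_grad_classical g) x
    = (euclid_grad f x \<bullet> euclid_grad g x) / (conf_factor x)\<^sup>2"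
  by (simp add: unit_grad_classical[OF assms] power2_eq_square divide_inverse mult_ac)

lemma unit_grad_classical_sq_integrable:
  assumes "f \<in> test_functions"
  shows "sq_integrable hyp_vol (unit_grad (hyp_grad_classical f))"
proof -
  have "continuous_on (ball 0 1) (\<lambda>x. euclid_grad f x /\<^sub>R conf_factor x)"
    using conf_factor_pos by (intro continuous_intros continuous_on_euclid_grad assms) force
  then have "continuous_on (ball 0 1) (unit_grad (hyp_grad_classical f))"
    by (rule continuous_on_eq) (simp add: unit_grad_classical)
  moreover have "integrable hyp_vol (\<lambda>x. (norm (unit_grad (hyp_grad_classical f) x))\<^sup>2)"
    using compact_cts_hyp_vol(1)[OF compact_cts_unit_grad_inner[OF assms assms]]
    by (rule iffD1[OF Bochner_Integration.integrable_cong[OF refl], rotated])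
       (auto simp: space_hyp_vol power2_norm_eq_inner unit_grad_inner_classical)
  ultimately show ?thesis
    by (simp add: sq_integrable_def continuous_on_borel_measurable_hyp_vol)
qed

text \<open>The volume density contributes the power \<open>DIM('a)\<close> of the conformal factor
  and the inverse metric removes two; in dimension at least \<open>2\<close> the subtraction of
  natural numbers is exact.\<close>

lemma unit_grad_inner_integral:
  fixes f g :: "'a::euclidean_space \<Rightarrow> real"
  assumes "f \<in> test_functions" "g \<in> test_functions" "2 \<le> DIM('a)"
  shows "(LINT x|hyp_vol. unit_grad (hyp_grad_classical f) x \<bullet> unit_grad (hyp_grad_classical g) x)
    = (LINT x|lborel. conf_factor x ^ (DIM('a) - 2) * (euclid_grad f x \<bullet> euclid_grad g x))"
proof -
  have "conf_factor x ^ DIM('a) * (c / (conf_factor x)\<^sup>2) = conf_factor x ^ (DIM('a) - 2) * c"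
    if "x \<in> ball 0 1" for x :: 'a and c
  proof -
    have "conf_factor x ^ DIM('a) = conf_factor x ^ (DIM('a) - 2) * (conf_factor x)\<^sup>2"
      by (metis assms(3) le_add_diff_inverse2 power_add)
    then show ?thesis
      using conf_factor_pos[OF that] by simp
  qed
  moreover have "euclid_grad f x = 0" if "x \<notin> ball 0 1" for x
  proof -
    obtain K where K: "compact K" "K \<subseteq> ball 0 1" "\<And>x. x \<notin> K \<Longrightarrow> f x = 0"
      using test_functions_support[OF assms(1)] by blast
    moreover from this that have "x \<notin> K" by blast
    ultimately show ?thesis
      using partial_outside_support[of K f x] compact_imp_closed[OF K(1)] by (auto simp: euclid_grad_def)
  qed
  ultimately have eq: "conf_factor x ^ DIM('a) * ((euclid_grad f x \<bullet> euclid_grad g x) / (conf_factor x)\<^sup>2)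
      = conf_factor x ^ (DIM('a) - 2) * (euclid_grad f x \<bullet> euclid_grad g x)" for x
    by (cases "x \<in> ball 0 1") auto
  have "(LINT x|hyp_vol. unit_grad (hyp_grad_classical f) x \<bullet> unit_grad (hyp_grad_classical g) x)
      = (LINT x|hyp_vol. (euclid_grad f x \<bullet> euclid_grad g x) / (conf_factor x)\<^sup>2)"
    by (intro hyp_vol_integral_cong unit_grad_inner_classical)
  also have "\<dots> = (LINT x|lborel. conf_factor x ^ (DIM('a) - 2) * (euclid_grad f x \<bullet> euclid_grad g x))"
    unfolding compact_cts_hyp_vol(2)[OF compact_cts_unit_grad_inner[OF assms(1,2)]] eq ..
  finally show ?thesis .
qed

lemma conf_factor_pred:
  assumes "x \<in> ball 0 1"
  shows "conf_factor x ^ m = conf_factor x ^ Suc m * ((1 - x \<bullet> x) / 2)"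
proof -
  have "conf_factor x * ((1 - x \<bullet> x) / 2) = 1"
    using conf_factor_pos[OF assms] by (auto simp: conf_factor_def dot_square_norm zero_less_divide_iff)
  then show ?thesis
    by (metis mult.assoc mult.commute mult.right_neutral power_Suc)
qed

text \<open>The constant comes from completing the square with the radial field \<open>(n / 2) tanh (\<rho> / 2) \<partial>\<^sub>\<rho>\<close>,
  where \<open>n = N - 1\<close> and \<open>\<rho>\<close> is the distance to the origin; in the Euclidean coordinates and with the
  volume density included it is \<open>(n / 2) p\<^sup>n x\<close>, where \<open>p\<close> is the conformal factor.\<close>

lemma poincare_test_function:
  fixes f :: "'a::euclidean_space \<Rightarrow> real"
  assumes f: "f \<in> test_functions" and dim: "2 \<le> DIM('a)"
  shows "(real DIM('a) - 1)\<^sup>2 / 4 * (LINT x|hyp_vol. (f x)\<^sup>2)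
    \<le> (LINT x|hyp_vol. (norm (unit_grad (hyp_grad_classical f) x))\<^sup>2)"
proof -
  define m where "m = DIM('a) - 1"
  define n where "n = real m"
  have N: "DIM('a) = Suc m" "DIM('a) - 2 = m - 1" "m = Suc (m - 1)" and n: "1 \<le> n" "real DIM('a) - 1 = n"
    using dim by (auto simp: m_def n_def)
  let ?p = "conf_factor :: 'a \<Rightarrow> real"
  \<comment> \<open>The derivative in direction \<open>b\<close> of the component along
    \<open>b\<close> of the field \<open>f\<^sup>2 p\<^sup>m x\<close>, with \<open>p\<close> the
    conformal factor. The sum \<open>S\<close> below is thus the Euclidean divergence of a compactly
    supported field.\<close>
  define D where "D x b = 2 * f x * partial b f x * (?p x ^ m * (x \<bullet> b))
      + (f x)\<^sup>2 * (n * ?p x ^ (m + 1) * (x \<bullet> b)\<^sup>2 + ?p x ^ m * (b \<bullet> b))" for x b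
  have cont: "continuous_on (ball 0 1) f" "\<And>b. b \<in> Basis \<Longrightarrow> continuous_on (ball 0 1) (partial b f)"
    using f test_function_partial[OF f] test_function_compact_cts by (auto simp: compact_cts_def)
  have cc_D: "compact_cts (\<lambda>x. D x b)" if "b \<in> Basis" for b
    unfolding D_def power2_eq_square[of "f _"] mult.assoc
    using test_function_compact_cts[OF f] cont that
    by (intro compact_cts_add compact_cts_mult(1)[of f] compact_cts_mult(2)[of _ "\<lambda>_. 2"] continuous_intros)
  have int_D: "(LINT x|lborel. D x b) = 0" if b: "b \<in> Basis" for b
  proof -
    define F where "F x = (f x)\<^sup>2 * (?p x ^ m * (x \<bullet> b))" for x
    \<comment> \<open>The full derivative of the component along the fixed \<open>b\<close>, in an
      arbitrary direction \<open>h\<close>; only \<open>h = b\<close> enters the divergence.\<close>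
    define D' where "D' x h = 2 * f x * partial h f x * (?p x ^ m * (x \<bullet> b))
        + (f x)\<^sup>2 * (n * ?p x ^ (m + 1) * (x \<bullet> h) * (x \<bullet> b) + ?p x ^ m * (h \<bullet> b))" for x h
    have eq: "D x b = D' x b" for x
      by (simp add: D_def D'_def power2_eq_square mult_ac)
    have "(LINT x|lborel. D' x b) = 0"
    proof (rule compact_cts_integral_directional_derivative)
      show "compact_cts F"
        unfolding F_def power2_eq_square mult.assoc using test_function_compact_cts[OF f] cont
        by (intro compact_cts_mult(1)[of f] continuous_intros)
      show "compact_cts (\<lambda>x. D' x b)"
        using cc_D[OF b] by (simp add: eq)
      fix x :: 'a
      assume x: "x \<in> ball 0 1"
      note d = conf_factor_has_derivative[OF x, of m] test_function_has_derivative[OF f, of x]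
      show "(F has_derivative D' x) (at x)"
        unfolding F_def[abs_def] D'_def[abs_def] n_def
        by (rule derivative_eq_intros d refl)+ (simp add: fun_eq_iff power2_eq_square algebra_simps)
    qed
    then show ?thesis by (simp add: eq)
  qed
  define S where "S x = (\<Sum>b\<in>Basis. D x b)" for x
  have cc_S: "compact_cts S" and int_S: "(LINT x|lborel. S x) = 0"
    unfolding S_def[abs_def] using cc_D int_D
    by (auto intro!: compact_cts_sum simp: compact_cts_integrable_lborel)
  have S_eq: "S x = 2 * f x * ?p x ^ m * (euclid_grad f x \<bullet> x)
      + (f x)\<^sup>2 * (n * ?p x ^ Suc m * (x \<bullet> x) + (n + 1) * ?p x ^ m)" for x
  proof -
    have "(\<Sum>b\<in>Basis. (x \<bullet> b)\<^sup>2) = x \<bullet> x"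
      using euclidean_inner[of x x] by (simp add: power2_eq_square)
    moreover have "(\<Sum>b\<in>(Basis::'a set). b \<bullet> b) = n + 1"
      using N by (simp add: n_def)
    moreover have "S x = 2 * f x * ?p x ^ m * (\<Sum>b\<in>Basis. partial b f x * (x \<bullet> b))
      + (f x)\<^sup>2 * (n * ?p x ^ Suc m * (\<Sum>b\<in>Basis. (x \<bullet> b)\<^sup>2) + ?p x ^ m * (\<Sum>b\<in>(Basis::'a set). b \<bullet> b))"
      unfolding S_def D_def sum_distrib_left sum.distrib[symmetric] by (simp add: mult_ac)
    ultimately show ?thesis
      by (simp add: inner_euclid_grad)
  qed
  let ?A = "\<lambda>x. ?p x ^ (m - 1) * (euclid_grad f x \<bullet> euclid_grad f x)"
  let ?C = "\<lambda>x. n\<^sup>2 / 4 * (?p x ^ Suc m * (f x)\<^sup>2)"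
  have pointwise: "?C x \<le> ?A x + n / 2 * S x" if x: "x \<in> ball 0 1" for x
  proof -
    define q where "q = x \<bullet> x"
    define P where "P = ?p x ^ Suc m"
    have q: "0 \<le> q" "q < 1"
      using x by (auto simp: q_def dot_square_norm abs_square_less_1)
    have P: "0 < P" "?p x ^ m = P * ((1 - q) / 2)"
      using conf_factor_pos[OF x] conf_factor_pred[OF x, of m] by (auto simp: P_def q_def)
    \<comment> \<open>The square to be completed. Weighted by \<open>p ^ (m - 1)\<close>, the cross
      term of \<open>v \<bullet> v\<close> is exactly the part of \<open>n / 2 * S x\<close> that
      contains the gradient of \<open>f\<close>.\<close>
    define v where "v = euclid_grad f x + (n / 2 * f x * ?p x) *\<^sub>R x"
    have p: "?p x ^ (m - 1) * ?p x = ?p x ^ m" "?p x ^ m * ?p x = P"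
      using N(3) by (auto simp: P_def mult.commute simp flip: power_Suc)
    have "0 \<le> ?p x ^ (m - 1) * (v \<bullet> v)"
      using conf_factor_pos[OF x] by (auto intro!: mult_nonneg_nonneg)
    also have "v \<bullet> v = euclid_grad f x \<bullet> euclid_grad f x + n * f x * ?p x * (euclid_grad f x \<bullet> x)
        + n\<^sup>2 / 4 * (f x)\<^sup>2 * (?p x * ?p x) * q"
      by (simp add: v_def q_def inner_simps inner_commute power2_eq_square algebra_simps)
    also have "?p x ^ (m - 1) * \<dots> = ?A x + n * f x * (?p x ^ (m - 1) * ?p x) * (euclid_grad f x \<bullet> x)
        + n\<^sup>2 / 4 * (f x)\<^sup>2 * (?p x ^ (m - 1) * ?p x * ?p x) * q"
      by (simp add: algebra_simps)
    also have "\<dots> = ?A x + n * f x * ?p x ^ m * (euclid_grad f x \<bullet> x) + n\<^sup>2 / 4 * (f x)\<^sup>2 * P * q"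
      unfolding p ..
    finally have 1: "0 \<le> ?A x + n * f x * ?p x ^ m * (euclid_grad f x \<bullet> x) + n\<^sup>2 / 4 * (f x)\<^sup>2 * P * q" .
    have "n / 2 * S x = n * f x * ?p x ^ m * (euclid_grad f x \<bullet> x)
        + (f x)\<^sup>2 * P * (n / 2 * (n * q + (n + 1) * ((1 - q) / 2)))"
      unfolding S_eq P_def[symmetric] q_def[symmetric] P(2) by (simp add: field_simps)
    \<comment> \<open>The first summand supplies the last term of the square, the second is the
      constant of the inequality, and the third is nonnegative because \<open>q < 1\<close>.\<close>
    also have "n / 2 * (n * q + (n + 1) * ((1 - q) / 2)) = n\<^sup>2 / 4 * q + n\<^sup>2 / 4 + n / 4 * (1 - q)"
      by (simp add: power2_eq_square field_simps)
    finally have 2: "n / 2 * S x = n * f x * ?p x ^ m * (euclid_grad f x \<bullet> x)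
        + n\<^sup>2 / 4 * (f x)\<^sup>2 * P * q + ?C x + (f x)\<^sup>2 * P * (n / 4 * (1 - q))"
      unfolding P_def[symmetric] by (simp add: algebra_simps)
    have "0 \<le> (f x)\<^sup>2 * P * (n / 4 * (1 - q))"
      using q P n by (intro mult_nonneg_nonneg) auto
    with 1 2 show ?thesis by linarith
  qed
  have cc_A: "compact_cts ?A" and cc_f2: "compact_cts (\<lambda>x. (f x)\<^sup>2)"
    unfolding power2_eq_square using test_function_compact_cts[OF f] cont
    by (auto intro!: compact_cts_mult(2)[of "\<lambda>x. euclid_grad f x \<bullet> euclid_grad f x"] compact_cts_mult(1)[of f]
      compact_cts_inner_euclid_grad f continuous_on_euclid_grad continuous_intros)
  then have cc_C: "compact_cts ?C"
    by (intro compact_cts_mult(2)[of "\<lambda>x. ?p x ^ Suc m * (f x)\<^sup>2"] compact_cts_mult(2)[of "\<lambda>x. (f x)\<^sup>2"] continuous_intros)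
  have "(LINT x|lborel. ?C x) \<le> (LINT x|lborel. ?A x + n / 2 * S x)"
  proof (rule integral_mono)
    fix x :: 'a
    show "?C x \<le> ?A x + n / 2 * S x"
    proof (cases "x \<in> ball 0 1")
      case False
      then have "?C x = 0" "?A x = 0" "S x = 0"
        using cc_C cc_A cc_S unfolding compact_cts_def by blast+
      then show ?thesis by (simp only: mult_zero_right add_0_left order_refl)
    qed (rule pointwise)
  qed (use compact_cts_integrable_lborel[OF cc_A] compact_cts_integrable_lborel[OF cc_S] compact_cts_integrable_lborel[OF cc_C] in auto)
  also have "\<dots> = (LINT x|lborel. ?A x)"
    using compact_cts_integrable_lborel[OF cc_A] compact_cts_integrable_lborel[OF cc_S] int_S by simp
  finally show ?thesis
    unfolding power2_norm_eq_inner unit_grad_inner_integral[OF f f dim] n(2) compact_cts_hyp_vol(2)[OF cc_f2] N(1,2) by (simp add: n_def)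
qed

lemma unit_grad_inner_by_parts:
  fixes h :: "'a::euclidean_space \<Rightarrow> real"
  assumes h: "h \<in> test_functions" and dim: "2 \<le> DIM('a)"
  shows "\<exists>Q. sq_integrable hyp_vol Q \<and> (\<forall>g\<in>test_functions.
    (LINT x|hyp_vol. unit_grad (hyp_grad_classical g) x \<bullet> unit_grad (hyp_grad_classical h) x)
      = (LINT x|hyp_vol. g x * Q x))"
proof -
  let ?p = "conf_factor :: 'a \<Rightarrow> real"
  define m where "m = DIM('a) - 2"
  define q where "q b x = real m * ?p x ^ (m + 1) * (x \<bullet> b) * partial b h x + ?p x ^ m * partial b (partial b h) x" for b x
  define Q where "Q x = - inverse (?p x ^ DIM('a)) * (\<Sum>b\<in>Basis. q b x)" for x
  have cc_h: "compact_cts (partial b h)" "compact_cts (partial b (partial b h))" if "b \<in> Basis" for b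
    using that h by (auto intro!: test_function_compact_cts test_function_partial)
  have cc_q: "compact_cts (q b)" if "b \<in> Basis" for b
    unfolding q_def[abs_def] by (intro compact_cts_add compact_cts_mult(2) cc_h that continuous_intros)
  have cc_Q: "compact_cts Q"
    unfolding Q_def[abs_def] using conf_factor_pos
    by (intro compact_cts_mult(2) compact_cts_sum cc_q continuous_intros) force+
  have "compact_cts (\<lambda>x. Q x * Q x)"
    using cc_Q by (intro compact_cts_mult(1)) (auto simp: compact_cts_def)
  then have "integrable hyp_vol (\<lambda>x. (norm (Q x))\<^sup>2)"
    by (simp add: power2_eq_square compact_cts_hyp_vol(1))
  moreover have "Q \<in> borel_measurable hyp_vol"
    using cc_Q by (intro continuous_on_borel_measurable_hyp_vol) (simp add: compact_cts_def)
  ultimately have "sq_integrable hyp_vol Q"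
    by (simp add: sq_integrable_def)
  moreover have "(LINT x|hyp_vol. unit_grad (hyp_grad_classical g) x \<bullet> unit_grad (hyp_grad_classical h) x)
      = (LINT x|hyp_vol. g x * Q x)" if g: "g \<in> test_functions" for g
  proof -
    have cc_g: "compact_cts g" "\<And>b. b \<in> Basis \<Longrightarrow> compact_cts (partial b g)"
      using g by (auto intro!: test_function_compact_cts test_function_partial)
    have cont_g: "continuous_on (ball 0 1) g"
      using cc_g by (simp add: compact_cts_def)
    have cont_h: "continuous_on (ball 0 1) (partial b h)" if "b \<in> Basis" for b
      using cc_h[OF that] by (simp add: compact_cts_def)
    have cc1: "compact_cts (\<lambda>x. ?p x ^ m * partial b h x * partial b g x)" if "b \<in> Basis" for b
      using that by (intro compact_cts_mult(2) cc_g continuous_intros cont_h)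
    have cc2: "compact_cts (\<lambda>x. g x * q b x)" if "b \<in> Basis" for b
      using that by (intro compact_cts_mult(2) cc_q cont_g)
    have parts: "(LINT x|lborel. ?p x ^ m * partial b h x * partial b g x) = - (LINT x|lborel. g x * q b x)"
      if b: "b \<in> Basis" for b
    proof -
      define D where "D x k = ?p x ^ m * partial b h x * partial k g x
        + g x * (real m * ?p x ^ (m + 1) * (x \<bullet> k) * partial b h x + ?p x ^ m * partial k (partial b h) x)" for x k
      have D: "D x b = ?p x ^ m * partial b h x * partial b g x + g x * q b x" for x
        by (simp add: D_def q_def)
      have "(LINT x|lborel. D x b) = 0"
      proof (rule compact_cts_integral_directional_derivative[where F = "\<lambda>x. g x * (?p x ^ m * partial b h x)"])
        show "compact_cts (\<lambda>x. g x * (?p x ^ m * partial b h x))"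
          using b by (intro compact_cts_mult(1) cc_g continuous_intros cont_h)
        show "compact_cts (\<lambda>x. D x b)"
          unfolding D by (intro compact_cts_add cc1 cc2 b)
        fix x :: 'a
        assume x: "x \<in> ball 0 1"
        note d = conf_factor_has_derivative[OF x, of m] test_function_has_derivative[OF g, of x]
          test_function_has_derivative[OF test_function_partial[OF h b], of x]
        show "((\<lambda>x. g x * (?p x ^ m * partial b h x)) has_derivative D x) (at x)"
          unfolding D_def[abs_def]
          by (rule derivative_eq_intros d refl)+ (simp add: fun_eq_iff algebra_simps)
      qed
      then show ?thesis
        unfolding D using compact_cts_integrable_lborel[OF cc1[OF b]] compact_cts_integrable_lborel[OF cc2[OF b]]
        by simp
    qed
    have "(LINT x|hyp_vol. unit_grad (hyp_grad_classical g) x \<bullet> unit_grad (hyp_grad_classical h) x)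
        = (LINT x|lborel. (\<Sum>b\<in>Basis. ?p x ^ m * partial b h x * partial b g x))"
      unfolding unit_grad_inner_integral[OF g h dim] m_def[symmetric]
      by (simp add: inner_euclid_grad euclid_grad_def[of h] sum_distrib_left mult_ac)
    also have "\<dots> = - (\<Sum>b\<in>Basis. LINT x|lborel. g x * q b x)"
      using parts compact_cts_integrable_lborel[OF cc1] by (simp add: sum_negf)
    also have "\<dots> = (LINT x|lborel. (- (\<Sum>b\<in>Basis. g x * q b x)))"
      using compact_cts_integrable_lborel[OF cc2] by simp
    also have "(\<lambda>x. - (\<Sum>b\<in>Basis. g x * q b x)) = (\<lambda>x. ?p x ^ DIM('a) * (g x * Q x))"
    proof
      fix x
      show "- (\<Sum>b\<in>Basis. g x * q b x) = ?p x ^ DIM('a) * (g x * Q x)"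
      proof (cases "x \<in> ball 0 1")
        case True
        have "?p x ^ DIM('a) * (g x * Q x) = - ((?p x ^ DIM('a) * inverse (?p x ^ DIM('a))) * (g x * (\<Sum>b\<in>Basis. q b x)))"
          by (simp add: Q_def)
        also have "?p x ^ DIM('a) * inverse (?p x ^ DIM('a)) = 1"
          using conf_factor_pos[OF True] by simp
        finally show ?thesis
          by (simp only: sum_distrib_left mult_1)
      next
        case False
        with cc_g have "g x = 0" unfolding compact_cts_def by blast
        then show ?thesis by simp
      qed
    qed
    also have "(LINT x|lborel. ?p x ^ DIM('a) * (g x * Q x)) = (LINT x|hyp_vol. g x * Q x)"
      using cc_Q cont_g by (intro compact_cts_hyp_vol(2)[symmetric] compact_cts_mult(2))
    finally show ?thesis .
  qed
  ultimately show ?thesis by blast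
qed

section \<open>The Sobolev space and its negative parts\<close>

lemma sq_tendsto_contraction:
  assumes F: "sq_tendsto M F f" and meas: "\<And>n. G n \<in> borel_measurable M" "g \<in> borel_measurable M"
    and bound: "\<And>n x. norm (G n x) \<le> norm (F n x)" "\<And>x. norm (g x) \<le> norm (f x)"
      "\<And>n x. norm (G n x - g x) \<le> norm (F n x - f x)"
  shows "sq_tendsto M G g"
proof -
  have int: "sq_integrable M (F n)" "sq_integrable M f" for n
    using F by (auto simp: sq_tendsto_def)
  have G: "sq_integrable M (G n)" and g: "sq_integrable M g" for n
    using bound by (auto intro: sq_integrable_bound[OF int(1) meas(1)] sq_integrable_bound[OF int(2) meas(2)])
  have "(\<lambda>n. LINT x|M. (norm (G n x - g x))\<^sup>2) \<longlonglongrightarrow> 0"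
  proof (rule tendsto_sandwich[OF _ _ tendsto_const])
    show "\<forall>\<^sub>F n in sequentially. (LINT x|M. (norm (G n x - g x))\<^sup>2) \<le> (LINT x|M. (norm (F n x - f x))\<^sup>2)"
      using int G g bound(3)
      by (intro always_eventually allI integral_mono sq_integrableD(2) sq_integrable_diff power_mono) auto
    show "(\<lambda>n. LINT x|M. (norm (F n x - f x))\<^sup>2) \<longlonglongrightarrow> 0"
      using F by (simp add: sq_tendsto_def)
  qed auto
  with G g show ?thesis
    by (simp add: sq_tendsto_def)
qed

lemma borel_measurable_conf_factor [measurable]: "conf_factor \<in> borel_measurable hyp_vol"
  by (intro continuous_on_borel_measurable_hyp_vol continuous_on_conf_factor)

lemma borel_measurable_unit_grad [measurable]:
  "G \<in> borel_measurable hyp_vol \<Longrightarrow> unit_grad G \<in> borel_measurable hyp_vol"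
  unfolding unit_grad_def[abs_def] by measurable

lemma has_hyp_grad_iff:
  "has_hyp_grad u G \<longleftrightarrow> u \<in> borel_measurable hyp_vol \<and> G \<in> borel_measurable hyp_vol \<and>
    (\<exists>f. (\<forall>n. f n \<in> test_functions) \<and> sq_tendsto hyp_vol f u \<and>
      sq_tendsto hyp_vol (\<lambda>n. unit_grad (hyp_grad_classical (f n))) (unit_grad G))"
proof -
  have norm: "hyp_inner x (v x - w x) (v x - w x) = (norm (unit_grad v x - unit_grad w x))\<^sup>2" for x :: 'a and v w
  proof -
    have "unit_grad v x - unit_grad w x = conf_factor x *\<^sub>R (v x - w x)"
      by (simp add: unit_grad_def scaleR_diff_right)
    then show ?thesis
      unfolding power2_norm_eq_inner by (simp add: hyp_inner_def power2_eq_square)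
  qed
  have "((\<lambda>n. \<integral>\<^sup>+x. ennreal ((f n x - u x)\<^sup>2) \<partial>hyp_vol) \<longlonglongrightarrow> 0 \<and>
        (\<lambda>n. \<integral>\<^sup>+x. ennreal (hyp_inner x (hyp_grad_classical (f n) x - G x)
                                     (hyp_grad_classical (f n) x - G x)) \<partial>hyp_vol) \<longlonglongrightarrow> 0) \<longleftrightarrow>
     (sq_tendsto hyp_vol f u \<and> sq_tendsto hyp_vol (\<lambda>n. unit_grad (hyp_grad_classical (f n))) (unit_grad G))"
    if "\<forall>n. f n \<in> test_functions" "u \<in> borel_measurable hyp_vol" "G \<in> borel_measurable hyp_vol" for f
  proof -
    have 1: "sq_integrable hyp_vol (f n)" "sq_integrable hyp_vol (unit_grad (hyp_grad_classical (f n)))" for n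
      using that(1) by (auto intro: test_function_sq_integrable unit_grad_classical_sq_integrable)
    show ?thesis
      unfolding norm
      using sq_tendsto_iff_nn_integral[OF 1(1) that(2)]
        sq_tendsto_iff_nn_integral[OF 1(2) borel_measurable_unit_grad[OF that(3)]]
      by simp
  qed
  then show ?thesis
    unfolding has_hyp_grad_def by blast
qed

lemma has_hyp_grad_sq_integrable:
  assumes "has_hyp_grad u G"
  shows "sq_integrable hyp_vol u" "sq_integrable hyp_vol (unit_grad G)"
  using assms by (auto simp: has_hyp_grad_iff sq_tendsto_def)

lemma has_hyp_grad_poincare:
  fixes u :: "'a::euclidean_space \<Rightarrow> real"
  assumes "has_hyp_grad u G" "2 \<le> DIM('a)"
  shows "(real DIM('a) - 1)\<^sup>2 / 4 * (LINT x|hyp_vol. (u x)\<^sup>2) \<le> (LINT x|hyp_vol. (norm (unit_grad G x))\<^sup>2)"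
proof -
  obtain f where f: "\<And>n. f n \<in> test_functions" "sq_tendsto hyp_vol f u"
      "sq_tendsto hyp_vol (\<lambda>n. unit_grad (hyp_grad_classical (f n))) (unit_grad G)"
    using assms(1) unfolding has_hyp_grad_iff by blast
  show ?thesis
  proof (rule LIMSEQ_le)
    show "(\<lambda>n. (real DIM('a) - 1)\<^sup>2 / 4 * (LINT x|hyp_vol. (f n x)\<^sup>2))
        \<longlonglongrightarrow> (real DIM('a) - 1)\<^sup>2 / 4 * (LINT x|hyp_vol. (u x)\<^sup>2)"
      using sq_tendsto_norm[OF f(2)] by (intro tendsto_mult_left) simp
    show "(\<lambda>n. LINT x|hyp_vol. (norm (unit_grad (hyp_grad_classical (f n)) x))\<^sup>2)
        \<longlonglongrightarrow> (LINT x|hyp_vol. (norm (unit_grad G x))\<^sup>2)"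
      by (rule sq_tendsto_norm[OF f(3)])
    show "\<exists>N. \<forall>n\<ge>N. (real DIM('a) - 1)\<^sup>2 / 4 * (LINT x|hyp_vol. (f n x)\<^sup>2)
        \<le> (LINT x|hyp_vol. (norm (unit_grad (hyp_grad_classical (f n)) x))\<^sup>2)"
      using poincare_test_function[OF f(1) assms(2)] by blast
  qed
qed

lemma hyp_grad_classical_diff:
  assumes "f \<in> test_functions" "g \<in> test_functions"
  shows "hyp_grad_classical (\<lambda>x. f x - g x) x = hyp_grad_classical f x - hyp_grad_classical g x"
proof -
  have "partial b (\<lambda>x. f x - g x) x = partial b f x - partial b g x" for b
    by (rule partial_eq[OF has_derivative_diff[OF assms[THEN test_function_has_derivative]]])
  then show ?thesis
    by (simp add: hyp_grad_classical_def scaleR_diff_left sum_subtractf scaleR_diff_right)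
qed

text \<open>Closability of the gradient. The differences \<open>g n\<close> of two approximating
  sequences tend to \<open>0\<close>, while their gradients \<open>V n\<close> tend to
  \<open>W\<close>. For fixed \<open>m\<close>, Green's formula turns the integral of
  \<open>V n \<bullet> V m\<close> into one of \<open>g n\<close> against a fixed function, so
  \<open>W\<close> is orthogonal to \<open>V m\<close>; letting \<open>m\<close> grow makes
  \<open>W\<close> orthogonal to itself.\<close>

lemma has_hyp_grad_unique:
  fixes u :: "'a::euclidean_space \<Rightarrow> real"
  assumes G: "has_hyp_grad u G" and H: "has_hyp_grad u H" and dim: "2 \<le> DIM('a)"
  shows "AE x in hyp_vol. unit_grad G x = unit_grad H x"
proof -
  obtain f where f: "\<And>n. f n \<in> test_functions" "sq_tendsto hyp_vol f u"
      "sq_tendsto hyp_vol (\<lambda>n. unit_grad (hyp_grad_classical (f n))) (unit_grad G)"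
    using G unfolding has_hyp_grad_iff by blast
  obtain h where h: "\<And>n. h n \<in> test_functions" "sq_tendsto hyp_vol h u"
      "sq_tendsto hyp_vol (\<lambda>n. unit_grad (hyp_grad_classical (h n))) (unit_grad H)"
    using H unfolding has_hyp_grad_iff by blast
  define g where "g n x = f n x - h n x" for n x
  define V where "V n = unit_grad (hyp_grad_classical (g n))" for n
  define W where "W x = unit_grad G x - unit_grad H x" for x
  have g: "g n \<in> test_functions" for n
    unfolding g_def[abs_def] using f(1) h(1) by (rule test_functions_diff)
  have g_0: "sq_tendsto hyp_vol g (\<lambda>x. 0)"
    using sq_tendsto_diff[OF f(2) h(2)] by (simp add: g_def[abs_def])
  have V_eq: "V = (\<lambda>n x. unit_grad (hyp_grad_classical (f n)) x - unit_grad (hyp_grad_classical (h n)) x)"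
    using hyp_grad_classical_diff[OF f(1) h(1)]
    by (simp add: fun_eq_iff V_def g_def[abs_def] unit_grad_def scaleR_diff_right)
  have V_W: "sq_tendsto hyp_vol V W"
    unfolding V_eq W_def[abs_def] by (rule sq_tendsto_diff[OF f(3) h(3)])
  then have V: "sq_integrable hyp_vol (V n)" and W: "sq_integrable hyp_vol W" for n
    by (auto simp: sq_tendsto_def)
  have "(LINT x|hyp_vol. W x \<bullet> V m x) = 0" for m
  proof -
    obtain Q where Q: "sq_integrable hyp_vol Q"
      "\<And>k. k \<in> test_functions \<Longrightarrow> (LINT x|hyp_vol. unit_grad (hyp_grad_classical k) x \<bullet> V m x) = (LINT x|hyp_vol. k x * Q x)"
      using unit_grad_inner_by_parts[OF g dim] unfolding V_def by blast
    have "(\<lambda>n. LINT x|hyp_vol. V n x \<bullet> V m x) \<longlonglongrightarrow> (LINT x|hyp_vol. W x \<bullet> V m x)"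
      by (rule sq_tendsto_inner[OF V_W V])
    moreover have "(\<lambda>n. LINT x|hyp_vol. V n x \<bullet> V m x) \<longlonglongrightarrow> 0"
      using sq_tendsto_inner[OF g_0 Q(1)] Q(2)[OF g] by (simp add: V_def)
    ultimately show ?thesis
      by (rule LIMSEQ_unique)
  qed
  then have "(LINT x|hyp_vol. V m x \<bullet> W x) = 0" for m
    by (simp only: inner_commute[of "V _ _"])
  then have "(LINT x|hyp_vol. W x \<bullet> W x) = 0"
    using sq_tendsto_inner[OF V_W W] by (simp add: LIMSEQ_const_iff)
  then have "AE x in hyp_vol. W x \<bullet> W x = 0"
    using sq_integrable_inner[OF W W] by (subst (asm) integral_nonneg_eq_0_iff_AE) auto
  then show ?thesis
    by (simp add: W_def)
qed

text \<open>A diagonal choice: for each \<open>k\<close>, take one test function that is within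
  \<open>1 / real (Suc k)\<close> in squared \<open>L\<^sup>2\<close> distance of \<open>U k\<close>
  and whose gradient is equally close to \<open>G k\<close>.\<close>

lemma has_hyp_grad_closed:
  assumes UG: "\<And>k. has_hyp_grad (U k) (G k)"
    and U: "sq_tendsto hyp_vol U u" and G: "sq_tendsto hyp_vol (\<lambda>k. unit_grad (G k)) (unit_grad H)"
    and H: "H \<in> borel_measurable hyp_vol"
  shows "has_hyp_grad u H"
proof -
  have "\<exists>f\<in>test_functions. (LINT x|hyp_vol. (norm (f x - U k x))\<^sup>2) \<le> 1 / real (Suc k) \<and>
      (LINT x|hyp_vol. (norm (unit_grad (hyp_grad_classical f) x - unit_grad (G k) x))\<^sup>2) \<le> 1 / real (Suc k)" for k
  proof -
    obtain f where f: "\<And>n. f n \<in> test_functions" "sq_tendsto hyp_vol f (U k)"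
        "sq_tendsto hyp_vol (\<lambda>n. unit_grad (hyp_grad_classical (f n))) (unit_grad (G k))"
      using UG[of k] unfolding has_hyp_grad_iff by blast
    have "\<forall>\<^sub>F n in sequentially. (LINT x|hyp_vol. (norm (f n x - U k x))\<^sup>2) < 1 / real (Suc k)"
      using f(2) by (intro order_tendstoD(2)[of _ 0]) (auto simp: sq_tendsto_def)
    moreover have "\<forall>\<^sub>F n in sequentially.
        (LINT x|hyp_vol. (norm (unit_grad (hyp_grad_classical (f n)) x - unit_grad (G k) x))\<^sup>2) < 1 / real (Suc k)"
      using f(3) by (intro order_tendstoD(2)[of _ 0]) (auto simp: sq_tendsto_def)
    ultimately have "\<forall>\<^sub>F n in sequentially. (LINT x|hyp_vol. (norm (f n x - U k x))\<^sup>2) < 1 / real (Suc k) \<and>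
        (LINT x|hyp_vol. (norm (unit_grad (hyp_grad_classical (f n)) x - unit_grad (G k) x))\<^sup>2) < 1 / real (Suc k)"
      by (rule eventually_conj)
    then obtain n where "(LINT x|hyp_vol. (norm (f n x - U k x))\<^sup>2) < 1 / real (Suc k)"
        "(LINT x|hyp_vol. (norm (unit_grad (hyp_grad_classical (f n)) x - unit_grad (G k) x))\<^sup>2) < 1 / real (Suc k)"
      using eventually_happens by force
    with f(1) show ?thesis
      by (intro bexI[of _ "f n"]) auto
  qed
  then have "\<forall>k. \<exists>f. f \<in> test_functions \<and> (LINT x|hyp_vol. (norm (f x - U k x))\<^sup>2) \<le> 1 / real (Suc k) \<and>
      (LINT x|hyp_vol. (norm (unit_grad (hyp_grad_classical f) x - unit_grad (G k) x))\<^sup>2) \<le> 1 / real (Suc k)"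
    by blast
  from choice[OF this] obtain f where f: "\<And>k. f k \<in> test_functions"
      "\<And>k. (LINT x|hyp_vol. (norm (f k x - U k x))\<^sup>2) \<le> 1 / real (Suc k)"
      "\<And>k. (LINT x|hyp_vol. (norm (unit_grad (hyp_grad_classical (f k)) x - unit_grad (G k) x))\<^sup>2) \<le> 1 / real (Suc k)"
    by blast
  have "sq_tendsto hyp_vol f u"
    using U f(2) by (rule sq_tendsto_diagonal[OF _ test_function_sq_integrable[OF f(1)]])
  moreover have "sq_tendsto hyp_vol (\<lambda>k. unit_grad (hyp_grad_classical (f k))) (unit_grad H)"
    using G f(3) by (rule sq_tendsto_diagonal[OF _ unit_grad_classical_sq_integrable[OF f(1)]])
  moreover have "u \<in> borel_measurable hyp_vol"
    using U by (simp add: sq_tendsto_def sq_integrable_def)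
  ultimately show ?thesis
    unfolding has_hyp_grad_iff using H f(1) by blast
qed

section \<open>Chain rule for negative parts in the Sobolev space\<close>

lemma borel_measurable_neg_part_approx [measurable]:
  assumes "0 < e"
  shows "neg_part_approx e \<in> borel_measurable borel" "neg_part_approx' e \<in> borel_measurable borel"
  using neg_part_approx_has_derivative[OF assms, THEN DERIV_isCont] isCont_neg_part_approx'[OF assms]
  by (auto intro!: borel_measurable_continuous_onI continuous_at_imp_continuous_on)

lemma abs_neg_part_approx_le: "0 < e \<Longrightarrow> \<bar>neg_part_approx e t\<bar> \<le> \<bar>t\<bar>"
  using neg_part_approx_lipschitz[of e t 0] by simp

lemma abs_neg_part_approx'_le: "0 < e \<Longrightarrow> \<bar>neg_part_approx' e t\<bar> \<le> 1"
  using neg_part_approx'_bounds[of e t] by simp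

lemma norm_scaleR_le: "\<bar>c\<bar> \<le> 1 \<Longrightarrow> norm (c *\<^sub>R v) \<le> norm v"
  by (simp add: mult_left_le_one_le)

lemma hyp_grad_classical_neg_part_approx:
  assumes "f \<in> test_functions" "0 < e"
  shows "hyp_grad_classical (\<lambda>x. neg_part_approx e (f x)) x = neg_part_approx' e (f x) *\<^sub>R hyp_grad_classical f x"
proof -
  have "partial b (\<lambda>x. neg_part_approx e (f x)) x = neg_part_approx' e (f x) * partial b f x" for b
    by (rule partial_eq[OF has_derivative_compose[OF test_function_has_derivative[OF assms(1)]
          neg_part_approx_has_derivative[OF assms(2), unfolded has_field_derivative_def]]])
  then show ?thesis
    by (simp add: hyp_grad_classical_def scaleR_sum_right mult_ac)
qed

lemma unit_grad_scaleR: "unit_grad (\<lambda>x. c x *\<^sub>R G x) x = c x *\<^sub>R unit_grad G x"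
  by (simp add: unit_grad_def mult.commute)

lemma has_hyp_grad_neg_part_approx:
  assumes "has_hyp_grad u G" and e: "0 < e"
  shows "has_hyp_grad (\<lambda>x. neg_part_approx e (u x)) (\<lambda>x. neg_part_approx' e (u x) *\<^sub>R G x)"
proof -
  obtain f0 where f0: "\<And>n. f0 n \<in> test_functions" "sq_tendsto hyp_vol f0 u"
      "sq_tendsto hyp_vol (\<lambda>n. unit_grad (hyp_grad_classical (f0 n))) (unit_grad G)"
    using assms(1) unfolding has_hyp_grad_iff by blast
  \<comment> \<open>In the chain rule the weight \<open>neg_part_approx' e\<close> is evaluated
    along the approximating functions. Its convergence is obtained pointwise from continuity, which
    calls for an almost everywhere convergent subsequence.\<close>
  obtain r where r: "strict_mono r" "AE x in hyp_vol. (\<lambda>n. f0 (r n) x) \<longlonglongrightarrow> u x"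
    using sq_tendsto_AE_subseq[OF f0(2)] by blast
  define f where "f n = f0 (r n)" for n
  define V where "V n = unit_grad (hyp_grad_classical (f n))" for n
  let ?J = "neg_part_approx e" and ?J' = "neg_part_approx' e"
  have f: "\<And>n. f n \<in> test_functions" "sq_tendsto hyp_vol f u" "sq_tendsto hyp_vol V (unit_grad G)"
    using f0 sq_tendsto_subseq[OF f0(2) r(1)] sq_tendsto_subseq[OF f0(3) r(1)]
    by (auto simp: f_def[abs_def] V_def[abs_def])
  have [measurable]: "u \<in> borel_measurable hyp_vol" "G \<in> borel_measurable hyp_vol"
    using assms(1) by (auto simp: has_hyp_grad_def)
  have [measurable]: "f n \<in> borel_measurable hyp_vol" "V n \<in> borel_measurable hyp_vol" for n
    using f by (auto simp: sq_tendsto_def sq_integrable_def)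
  note [measurable] = borel_measurable_neg_part_approx[OF e]
  have "sq_tendsto hyp_vol (\<lambda>n x. ?J (f n x)) (\<lambda>x. ?J (u x))"
    using f(2) by (rule sq_tendsto_contraction)
      (auto simp: abs_neg_part_approx_le[OF e] neg_part_approx_lipschitz[OF e])
  \<comment> \<open>The product of weight and gradient varies in both factors. It is split into the
    varying weight times the fixed limit gradient, handled by dominated convergence, and the varying
    weight times the gradient error, which tends to \<open>0\<close> because the weight is at most
    \<open>1\<close> in absolute value.\<close>
  moreover have "sq_tendsto hyp_vol (\<lambda>n x. ?J' (f n x) *\<^sub>R unit_grad G x - ?J' (f n x) *\<^sub>R (unit_grad G x - V n x))
      (\<lambda>x. ?J' (u x) *\<^sub>R unit_grad G x - 0)"
  proof (rule sq_tendsto_diff)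
    show "sq_tendsto hyp_vol (\<lambda>n x. ?J' (f n x) *\<^sub>R unit_grad G x) (\<lambda>x. ?J' (u x) *\<^sub>R unit_grad G x)"
    proof (rule sq_tendsto_dominated)
      show "sq_integrable hyp_vol (unit_grad G)"
        by (rule has_hyp_grad_sq_integrable(2)[OF assms(1)])
      show "AE x in hyp_vol. norm (?J' (f n x) *\<^sub>R unit_grad G x) \<le> norm (unit_grad G x)" for n
        by (intro AE_I2 norm_scaleR_le abs_neg_part_approx'_le e)
      show "AE x in hyp_vol. (\<lambda>n. ?J' (f n x) *\<^sub>R unit_grad G x) \<longlonglongrightarrow> ?J' (u x) *\<^sub>R unit_grad G x"
        using r(2)
      proof eventually_elim
        case (elim x)
        then show ?case
          unfolding f_def
          by (intro tendsto_scaleR tendsto_const isCont_tendsto_compose[OF isCont_neg_part_approx'[OF e]])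
      qed
    qed measurable
    have "sq_tendsto hyp_vol (\<lambda>n x. unit_grad G x - V n x) (\<lambda>x. unit_grad G x - unit_grad G x)"
      using f(3) has_hyp_grad_sq_integrable(2)[OF assms(1)]
      by (intro sq_tendsto_diff) (auto simp: sq_tendsto_def)
    then show "sq_tendsto hyp_vol (\<lambda>n x. ?J' (f n x) *\<^sub>R (unit_grad G x - V n x)) (\<lambda>x. 0)"
      by (rule sq_tendsto_contraction) (auto simp: mult_left_le_one_le abs_neg_part_approx'_le[OF e])
  qed
  then have "sq_tendsto hyp_vol (\<lambda>n x. ?J' (f n x) *\<^sub>R V n x) (\<lambda>x. ?J' (u x) *\<^sub>R unit_grad G x)"
    by (simp add: scaleR_diff_right)
  then have "sq_tendsto hyp_vol (\<lambda>n. unit_grad (hyp_grad_classical (\<lambda>x. ?J (f n x))))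
      (unit_grad (\<lambda>x. ?J' (u x) *\<^sub>R G x))"
    unfolding unit_grad_scaleR[abs_def] hyp_grad_classical_neg_part_approx[OF f(1) e, abs_def] V_def .
  moreover have "(\<lambda>x. ?J (f n x)) \<in> test_functions" for n
    using f(1) e by (rule test_functions_neg_part_approx)
  ultimately show ?thesis
    unfolding has_hyp_grad_iff by (intro conjI exI[of _ "\<lambda>n x. ?J (f n x)"]) auto
qed

text \<open>The weight of \<open>G\<close> on \<open>{u = 0}\<close> is \<open>- 1/2\<close>, the limit of the derivatives of the approximations at
  \<open>0\<close>. It is harmless, since the weight \<open>c\<close> enters the main estimate only through \<open>c\<^sup>2 \<le> - c\<close>.\<close>

lemma has_hyp_grad_neg_part:
  assumes "has_hyp_grad u G"
  shows "has_hyp_grad (\<lambda>x. max (- u x) 0) (\<lambda>x. ((sgn (u x) - 1) / 2) *\<^sub>R G x)"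
proof -
  define e where "e n = 1 / real (Suc n)" for n
  have e: "0 < e n" for n by (simp add: e_def)
  have e_0: "e \<longlonglongrightarrow> 0"
    unfolding e_def[abs_def] by (rule LIMSEQ_Suc[OF lim_1_over_n])
  have [measurable]: "u \<in> borel_measurable hyp_vol" "G \<in> borel_measurable hyp_vol"
    using assms by (auto simp: has_hyp_grad_def)
  note [measurable] = borel_measurable_neg_part_approx[OF e]
  show ?thesis
  proof (rule has_hyp_grad_closed[OF has_hyp_grad_neg_part_approx[OF assms e]])
    show "sq_tendsto hyp_vol (\<lambda>n x. neg_part_approx (e n) (u x)) (\<lambda>x. max (- u x) 0)"
      by (rule sq_tendsto_dominated[OF _ _ has_hyp_grad_sq_integrable(1)[OF assms]])
        (auto simp: abs_neg_part_approx_le[OF e] intro!: neg_part_approx_tendsto e_0)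
    show "sq_tendsto hyp_vol (\<lambda>n. unit_grad (\<lambda>x. neg_part_approx' (e n) (u x) *\<^sub>R G x))
        (unit_grad (\<lambda>x. ((sgn (u x) - 1) / 2) *\<^sub>R G x))"
      unfolding unit_grad_scaleR[abs_def]
    proof (rule sq_tendsto_dominated[OF _ _ has_hyp_grad_sq_integrable(2)[OF assms]])
      show "AE x in hyp_vol. norm (neg_part_approx' (e n) (u x) *\<^sub>R unit_grad G x) \<le> norm (unit_grad G x)" for n
        by (intro AE_I2 norm_scaleR_le abs_neg_part_approx'_le e)
      show "AE x in hyp_vol. (\<lambda>n. neg_part_approx' (e n) (u x) *\<^sub>R unit_grad G x)
          \<longlonglongrightarrow> ((sgn (u x) - 1) / 2) *\<^sub>R unit_grad G x"
        by (intro AE_I2 tendsto_scaleR tendsto_const neg_part_approx'_tendsto e_0)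
    qed measurable
  qed measurable
qed

section \<open>Positivity of the hyperbolic distance and sign of the nonlocal term\<close>

lemma norm_mobius_T_sq:
  assumes "x \<in> ball 0 1" "y \<in> ball 0 1"
  defines "d \<equiv> 1 - 2 * (y \<bullet> x) + (norm y)\<^sup>2 * (norm x)\<^sup>2"
  shows "(norm (mobius_T x y))\<^sup>2 = (norm (y - x))\<^sup>2 / d" "(norm (y - x))\<^sup>2 < d"
proof -
  \<comment> \<open>This factorization makes the image of \<open>y\<close> under the Moebius map lie
    strictly inside the unit ball.\<close>
  have "d - (norm (y - x))\<^sup>2 = (1 - (norm x)\<^sup>2) * (1 - (norm y)\<^sup>2)"
    by (simp add: d_def power2_norm_eq_inner inner_simps inner_commute algebra_simps)
  moreover have "0 < (1 - (norm x)\<^sup>2) * (1 - (norm y)\<^sup>2)"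
    using assms(1,2) by (intro mult_pos_pos) (auto simp: abs_square_less_1)
  ultimately show d: "(norm (y - x))\<^sup>2 < d" by linarith
  define w where "w = (norm (y - x))\<^sup>2 *\<^sub>R x - (1 - (norm x)\<^sup>2) *\<^sub>R (y - x)"
  \<comment> \<open>The squared norm of the numerator contains one factor \<open>d\<close>, which
    cancels against the \<open>d\<^sup>2\<close> coming from the denominator.\<close>
  have w: "(norm ((norm (y - x))\<^sup>2 *\<^sub>R x - (1 - (norm x)\<^sup>2) *\<^sub>R (y - x)))\<^sup>2 = (norm (y - x))\<^sup>2 * d"
  proof -
    define A B C where "A = x \<bullet> x" and "B = x \<bullet> y" and "C = y \<bullet> y"
    have *: "y \<bullet> x = B" "x \<bullet> x = A" "x \<bullet> y = B" "y \<bullet> y = C"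
      by (auto simp: A_def B_def C_def inner_commute)
    show ?thesis
      unfolding d_def power2_norm_eq_inner inner_simps * by (simp add: algebra_simps)
  qed
  have "0 < d"
    using d zero_le_power2[of "norm (y - x)"] by linarith
  have "(norm (w /\<^sub>R d))\<^sup>2 = (norm w)\<^sup>2 / d\<^sup>2"
    by (simp add: power_mult_distrib power_inverse divide_inverse mult.commute)
  also have "\<dots> = (norm (y - x))\<^sup>2 / d"
    unfolding w_def w using \<open>0 < d\<close> by (simp add: power2_eq_square)
  finally show "(norm (mobius_T x y))\<^sup>2 = (norm (y - x))\<^sup>2 / d"
    unfolding mobius_T_def d_def[symmetric] w_def .
qed

lemma hyp_dist_pos:
  assumes "x \<in> ball 0 1" "y \<in> ball 0 1" "x \<noteq> y"
  shows "0 < hyp_dist x y"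
proof -
  define t where "t = norm (mobius_T x y)"
  have d: "0 < (norm (y - x))\<^sup>2"
    using assms(3) by simp
  have "0 < t\<^sup>2" "t\<^sup>2 < 1"
    unfolding t_def norm_mobius_T_sq(1)[OF assms(1,2)]
    using d norm_mobius_T_sq(2)[OF assms(1,2)] less_trans[OF d norm_mobius_T_sq(2)[OF assms(1,2)]]
    by (simp_all only: divide_pos_pos divide_less_eq_1_pos)
  then have "0 < t" "t < 1"
    using norm_ge_zero[of "mobius_T x y"] abs_square_less_1[of t] zero_less_power2[of t]
    unfolding t_def by linarith+
  then have "1 < (1 + t) / (1 - t)"
    by simp
  then show ?thesis
    unfolding hyp_dist_def t_def[symmetric] by (rule ln_gt_zero)
qed

text \<open>The function \<open>max (- t) 0\<close> is nonincreasing in \<open>t\<close>, so its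
  increments have the opposite sign to those of \<open>u\<close>, and the kernel is nonnegative at
  positive distances.\<close>

lemma kernel_form_neg_part_nonpos:
  fixes u :: "'a::euclidean_space \<Rightarrow> real"
  assumes "2 \<le> DIM('a)" "0 < s"
  shows "(LINT y|hyp_vol. LINT x|hyp_vol.
     (u x - u y) * (max (- u x) 0 - max (- u y) 0) * frac_kernel DIM('a) s (hyp_dist x y)) \<le> 0"
proof -
  have "0 \<le> - ((u x - u y) * (max (- u x) 0 - max (- u y) 0) * frac_kernel DIM('a) s (hyp_dist x y))"
    if "x \<in> ball 0 1" "y \<in> ball 0 1" for x y
  \<comment> \<open>On the diagonal the distance is not positive, but there the increment
    \<open>u x - u y\<close> is zero.\<close>
  proof (cases "x = y")
    case False
    have "0 \<le> frac_kernel DIM('a) s (hyp_dist x y)"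
      using assms hyp_dist_pos[OF that False] by (intro frac_kernel_nonneg)
    moreover have "(u x - u y) * (max (- u x) 0 - max (- u y) 0) \<le> 0"
      by (auto simp: max_def mult_nonneg_nonpos mult_nonpos_nonneg mult_le_0_iff)
    ultimately show ?thesis
      by (simp add: mult_nonpos_nonneg)
  qed simp
  \<comment> \<open>The sign passes through the iterated integral without a convergence argument: an
    integral that does not converge has the value \<open>0\<close>, and negation commutes with the
    integral in that case too.\<close>
  then have "0 \<le> (LINT y|hyp_vol. LINT x|hyp_vol.
     - ((u x - u y) * (max (- u x) 0 - max (- u y) 0) * frac_kernel DIM('a) s (hyp_dist x y)))"
    by (intro integral_nonneg_AE AE_hyp_volI) auto
  then show ?thesis by simp
qed

theorem lemma5p1:
  fixes u :: "'a::euclidean_space \<Rightarrow> real" and s lam :: real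
  assumes "DIM('a) \<ge> 2"
    and "0 < s" and "s < 1"
    and "lam < (real DIM('a) - 1)\<^sup>2 / 4"
    and "u \<in> hyp_H1"
    and "weak_L_nonneg s lam u"
  shows "AE x in hyp_vol. u x \<ge> 0"
proof -
  define G where "G = hyp_grad u"
  define \<phi> where "\<phi> x = max (- u x) 0" for x
  define c where "c x = (sgn (u x) - 1) / 2" for x
  define V where "V = unit_grad G"
  have hyp_grad: "has_hyp_grad v (hyp_grad v)" if "v \<in> hyp_H1" for v :: "'a \<Rightarrow> real"
    using that unfolding hyp_H1_def hyp_grad_def mem_Collect_eq by (rule someI_ex)
  have G: "has_hyp_grad u G"
    unfolding G_def by (rule hyp_grad[OF assms(5)])
  have \<phi>: "has_hyp_grad \<phi> (\<lambda>x. c x *\<^sub>R G x)"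
    using has_hyp_grad_neg_part[OF G] by (simp add: \<phi>_def[abs_def] c_def)
  then have \<phi>_H1: "\<phi> \<in> hyp_H1"
    by (auto simp: hyp_H1_def)
  have V: "sq_integrable hyp_vol V" and cV: "sq_integrable hyp_vol (\<lambda>x. c x *\<^sub>R V x)"
    using has_hyp_grad_sq_integrable(2)[OF G] has_hyp_grad_sq_integrable(2)[OF \<phi>]
    by (simp_all add: V_def unit_grad_scaleR[abs_def])
  have \<phi>_sq: "sq_integrable hyp_vol \<phi>"
    by (rule has_hyp_grad_sq_integrable(1)[OF \<phi>])
  \<comment> \<open>The weak form contains the chosen representative \<open>hyp_grad \<phi>\<close>;
    uniqueness allows the explicit multiple of the gradient of \<open>u\<close> to be used
    instead.\<close>
  have grad_\<phi>: "AE x in hyp_vol. unit_grad (hyp_grad \<phi>) x = c x *\<^sub>R V x"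
    using has_hyp_grad_unique[OF hyp_grad[OF \<phi>_H1] \<phi> assms(1)] by (simp add: unit_grad_scaleR V_def)
  have meas: "unit_grad (hyp_grad \<phi>) \<in> borel_measurable hyp_vol"
    using has_hyp_grad_sq_integrable(2)[OF hyp_grad[OF \<phi>_H1]] by (simp add: sq_integrable_def)
  have "(LINT x|hyp_vol. hyp_inner x (hyp_grad u x) (hyp_grad \<phi> x)) = (LINT x|hyp_vol. V x \<bullet> (c x *\<^sub>R V x))"
    unfolding hyp_inner_unit_grad G_def[symmetric] V_def[symmetric]
  proof (rule integral_cong_AE)
    show "(\<lambda>x. V x \<bullet> unit_grad (hyp_grad \<phi>) x) \<in> borel_measurable hyp_vol"
      using sq_integrableD(1)[OF V] meas by measurable
    show "(\<lambda>x. V x \<bullet> (c x *\<^sub>R V x)) \<in> borel_measurable hyp_vol"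
      using sq_integrableD(1)[OF V] sq_integrableD(1)[OF cV] by measurable
    show "AE x in hyp_vol. V x \<bullet> unit_grad (hyp_grad \<phi>) x = V x \<bullet> (c x *\<^sub>R V x)"
      using grad_\<phi> by eventually_elim simp
  qed
  also have "\<dots> \<le> (LINT x|hyp_vol. - (norm (c x *\<^sub>R V x))\<^sup>2)"
  proof (rule integral_mono)
    show "V x \<bullet> (c x *\<^sub>R V x) \<le> - (norm (c x *\<^sub>R V x))\<^sup>2" for x
    proof -
      \<comment> \<open>\<open>c x\<close> is \<open>0\<close>, \<open>- 1 / 2\<close> or
        \<open>- 1\<close> according to whether \<open>u x\<close> is positive, zero or
        negative.\<close>
      have "c x + (c x)\<^sup>2 \<le> 0"
        by (simp add: c_def sgn_if power2_eq_square)
      then have "(c x + (c x)\<^sup>2) * (V x \<bullet> V x) \<le> 0"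
        by (intro mult_nonpos_nonneg) auto
      then show ?thesis
        unfolding power2_norm_eq_inner by (simp add: power2_eq_square algebra_simps)
    qed
  qed (use sq_integrable_inner[OF V cV] sq_integrableD(2)[OF cV] in auto)
  also have "\<dots> = - (LINT x|hyp_vol. (norm (c x *\<^sub>R V x))\<^sup>2)"
    by simp
  also have "\<dots> \<le> - ((real DIM('a) - 1)\<^sup>2 / 4 * (LINT x|hyp_vol. (\<phi> x)\<^sup>2))"
    using has_hyp_grad_poincare[OF \<phi> assms(1)] by (simp add: unit_grad_scaleR V_def)
  finally have gradient: "(LINT x|hyp_vol. hyp_inner x (hyp_grad u x) (hyp_grad \<phi> x))
      \<le> - ((real DIM('a) - 1)\<^sup>2 / 4 * (LINT x|hyp_vol. (\<phi> x)\<^sup>2))" .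
  have "u x * \<phi> x = - (\<phi> x)\<^sup>2" for x
    by (simp add: \<phi>_def max_def power2_eq_square)
  then have mass: "(LINT x|hyp_vol. u x * \<phi> x) = - (LINT x|hyp_vol. (\<phi> x)\<^sup>2)"
    by simp
  have "0 \<le> L_form s lam u \<phi>"
    using assms(6) \<phi>_H1 by (auto simp: weak_L_nonneg_def \<phi>_def)
  \<comment> \<open>The gradient term is at most minus the spectral constant times the integral of
    \<open>\<phi>\<^sup>2\<close>, the nonlocal term is at most \<open>0\<close>, and the
    zeroth-order term equals \<open>lam\<close> times that same integral.\<close>
  then have "((real DIM('a) - 1)\<^sup>2 / 4 - lam) * (LINT x|hyp_vol. (\<phi> x)\<^sup>2) \<le> 0"
    using gradient kernel_form_neg_part_nonpos[OF assms(1,2), of u]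
    unfolding L_form_def mass \<phi>_def[symmetric] by (simp add: algebra_simps)
  then have "(LINT x|hyp_vol. (\<phi> x)\<^sup>2) \<le> 0"
    using assms(4) by (simp add: mult_le_0_iff)
  moreover have "0 \<le> (LINT x|hyp_vol. (\<phi> x)\<^sup>2)"
    by simp
  ultimately have "(LINT x|hyp_vol. (\<phi> x)\<^sup>2) = 0"
    by linarith
  then have "AE x in hyp_vol. (\<phi> x)\<^sup>2 = 0"
    using sq_integrableD(2)[OF \<phi>_sq] by (subst (asm) integral_nonneg_eq_0_iff_AE) auto
  then show ?thesis
    by eventually_elim (simp add: \<phi>_def max_def split: if_splits)
qed

end
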